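(* Let $R$ be a commutative ring in which $6$ is invertible. Let $\mathfrak{g}$ be a Lie algebra over $R$ graded in an abelian group $A$ endowed with an injective group homomorphism $\phi$ from $A$ into (the additive group of) a subfield of $R$. Then the reduced Koszul map of $\mathfrak{g}$ is concentrated in degree $0$, i.e. $\bar\eta(H_3(\mathfrak{g})_\alpha)=0$ for every $\alpha\in A\smallsetminus\{0\}$.
   Context: Tensor, exterior and symmetric powers are over $R$. $H_*(\mathfrak{g})$ is the homology of the Chevalley–Eilenberg complex $\Lambda^*\mathfrak{g}$ with $\partial_n(x_1\wedge\dots\wedge x_n)=\sum_{i<j}(-1)^{i+j}[x_i,x_j]\wedge x_1\wedge\dots\wedge\hat{x_i}\wedge\dots\wedge\hat{x_j}\wedge\dots\wedge x_n$, and $Z_3(\mathfrak{g})=\ker\partial_3$. Writing $x\odot y$ for the product in the symmetric square $S^2\mathfrak{g}$, the Killing module $\mathrm{Kill}(\mathfrak{g})$ is the cokernel of $\mathfrak{g}^{\otimes 3}\to S^2\mathfrak{g}$, $x\otimes y\otimes z\mapsto [x,y]\odot z-x\odot[y,z]$. The Koszul map $\eta:\Lambda^3\mathfrak{g}\to\mathrm{Kill}(\mathfrak{g})$ sends $x\wedge y\wedge z$ to the class of $x\odot[y,z]$; it vanishes on 3-boundaries, and the reduced Koszul map $\bar\eta:H_3(\mathfrak{g})\to\mathrm{Kill}(\mathfrak{g})$ is induced by restricting $\eta$ to $Z_3(\mathfrak{g})$. A grading $\mathfrak{g}=\bigoplus_{\alpha\in A}\mathfrak{g}_\alpha$ with $[\mathfrak{g}_\alpha,\mathfrak{g}_\beta]\subset\mathfrak{g}_{\alpha+\beta}$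 induces $A$-gradings on exterior and symmetric powers (degrees add), hence on $H_3(\mathfrak{g})$ and $\mathrm{Kill}(\mathfrak{g})$, and $\bar\eta$ is graded. A subfield of $R$ is a unital subring that is a field. *)

theory Defs
  imports "HOL-Algebra.Module" "HOL-Algebra.Subrings"
begin

section \<open>Quotient modules and free modules\<close>

text \<open>The fields \<open>mult\<close> and \<open>one\<close> of a \<^typ>\<open>('a, 'b) module\<close> record play no role in the locale
  \<^locale>\<open>module\<close>; here they are filled with dummies.\<close>

definition quot_module :: "('r, 'm, 'e) module_scheme \<Rightarrow> 'm set \<Rightarrow> ('r, 'm set) module" where
  "quot_module M N =
    \<lparr>carrier = a_rcosets\<^bsub>M\<^esub> N, mult = (\<lambda>_ _. N), one = N,
     zero = N, add = set_add M, smult = (\<lambda>a C. \<Union>x\<in>C. N +>\<^bsub>M\<^esub> (a \<odot>\<^bsub>M\<^esub> x))\<rparr>"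

text \<open>The map that \<open>h\<close> induces on a quotient; meaningful when \<open>h\<close> is constant on each coset.\<close>

definition quot_lift :: "('m \<Rightarrow> 'p) \<Rightarrow> 'm set \<Rightarrow> 'p" where
  "quot_lift h C = the_elem (h ` C)"

definition submod_span ::
  "('r, 'q) ring_scheme \<Rightarrow> ('r, 'm, 'e) module_scheme \<Rightarrow> 'm set \<Rightarrow> 'm set" where
  "submod_span R M S = (\<lambda>N. submodule N R M) hull S"

definition free_module :: "('r, 'q) ring_scheme \<Rightarrow> 'x set \<Rightarrow> ('r, 'x \<Rightarrow> 'r) module" where
  "free_module R B =
    \<lparr>carrier = {c. range c \<subseteq> carrier R \<and> {x. c x \<noteq> \<zero>\<^bsub>R\<^esub>} \<subseteq> B \<and> finite {x. c x \<noteq> \<zero>\<^bsub>R\<^esub>}},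
     mult = (\<lambda>_ _ _. \<zero>\<^bsub>R\<^esub>), one = (\<lambda>_. \<zero>\<^bsub>R\<^esub>),
     zero = (\<lambda>_. \<zero>\<^bsub>R\<^esub>), add = (\<lambda>c d x. c x \<oplus>\<^bsub>R\<^esub> d x), smult = (\<lambda>a c x. a \<otimes>\<^bsub>R\<^esub> c x)\<rparr>"

definition free_gen :: "('r, 'q) ring_scheme \<Rightarrow> 'x \<Rightarrow> 'x \<Rightarrow> 'r" where
  "free_gen R x = (\<lambda>y. if y = x then \<one>\<^bsub>R\<^esub> else \<zero>\<^bsub>R\<^esub>)"

definition free_lift ::
  "('r, 'q) ring_scheme \<Rightarrow> ('r, 'p, 'e) module_scheme \<Rightarrow> ('x \<Rightarrow> 'p) \<Rightarrow> ('x \<Rightarrow> 'r) \<Rightarrow> 'p" where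
  "free_lift R P f c = (\<Oplus>\<^bsub>P\<^esub>x\<in>{x. c x \<noteq> \<zero>\<^bsub>R\<^esub>}. c x \<odot>\<^bsub>P\<^esub> f x)"


section \<open>Tensor, exterior and symmetric powers\<close>

definition tuples :: "('r, 'g, 'e) module_scheme \<Rightarrow> nat \<Rightarrow> 'g list set" where
  "tuples L n = {xs. length xs = n \<and> set xs \<subseteq> carrier L}"

definition tensor_rels ::
  "('r, 'q) ring_scheme \<Rightarrow> ('r, 'g, 'e) module_scheme \<Rightarrow> nat \<Rightarrow> ('g list \<Rightarrow> 'r) set" where
  "tensor_rels R L n =
    (let F = free_module R (tuples L n) in
      {free_gen R (xs @ [x \<oplus>\<^bsub>L\<^esub> y] @ ys)
         \<ominus>\<^bsub>F\<^esub> (free_gen R (xs @ [x] @ ys) \<oplus>\<^bsub>F\<^esub> free_gen R (xs @ [y] @ ys))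
        | xs x y ys. xs @ [x] @ ys \<in> tuples L n \<and> y \<in> carrier L}
      \<union> {free_gen R (xs @ [a \<odot>\<^bsub>L\<^esub> x] @ ys) \<ominus>\<^bsub>F\<^esub> a \<odot>\<^bsub>F\<^esub> free_gen R (xs @ [x] @ ys)
        | xs a x ys. xs @ [x] @ ys \<in> tuples L n \<and> a \<in> carrier R})"

definition tensor_power ::
  "('r, 'q) ring_scheme \<Rightarrow> ('r, 'g, 'e) module_scheme \<Rightarrow> nat \<Rightarrow> ('r, ('g list \<Rightarrow> 'r) set) module" where
  "tensor_power R L n =
    (let F = free_module R (tuples L n) in quot_module F (submod_span R F (tensor_rels R L n)))"

definition tensor ::
  "('r, 'q) ring_scheme \<Rightarrow> ('r, 'g, 'e) module_scheme \<Rightarrow> 'g list \<Rightarrow> ('g list \<Rightarrow> 'r) set" where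
  "tensor R L xs =
    (let F = free_module R (tuples L (length xs))
     in submod_span R F (tensor_rels R L (length xs)) +>\<^bsub>F\<^esub> free_gen R xs)"

definition tensor_lift ::
  "('r, 'q) ring_scheme \<Rightarrow> ('r, 'p, 'e) module_scheme \<Rightarrow> ('g list \<Rightarrow> 'p) \<Rightarrow> ('g list \<Rightarrow> 'r) set \<Rightarrow> 'p" where
  "tensor_lift R P f = quot_lift (free_lift R P f)"

text \<open>The \<open>n\<close>-th exterior power is the degree-\<open>n\<close> part of the tensor algebra modulo the ideal
  generated by the squares \<open>x \<otimes> x\<close>.\<close>

definition ext_rels ::
  "('r, 'q) ring_scheme \<Rightarrow> ('r, 'g, 'e) module_scheme \<Rightarrow> nat \<Rightarrow> ('g list \<Rightarrow> 'r) set set" where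
  "ext_rels R L n = {tensor R L (xs @ [x, x] @ ys) | xs x ys. xs @ [x, x] @ ys \<in> tuples L n}"

definition ext_power ::
  "('r, 'q) ring_scheme \<Rightarrow> ('r, 'g, 'e) module_scheme \<Rightarrow> nat \<Rightarrow>
    ('r, ('g list \<Rightarrow> 'r) set set) module" where
  "ext_power R L n =
    quot_module (tensor_power R L n) (submod_span R (tensor_power R L n) (ext_rels R L n))"

definition wedge ::
  "('r, 'q) ring_scheme \<Rightarrow> ('r, 'g, 'e) module_scheme \<Rightarrow> 'g list \<Rightarrow> ('g list \<Rightarrow> 'r) set set" where
  "wedge R L xs =
    (let n = length xs; T = tensor_power R L n
     in submod_span R T (ext_rels R L n) +>\<^bsub>T\<^esub> tensor R L xs)"

definition ext_lift ::
  "('r, 'q) ring_scheme \<Rightarrow> ('r, 'p, 'e) module_scheme \<Rightarrow> ('g list \<Rightarrow> 'p) \<Rightarrow>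
    ('g list \<Rightarrow> 'r) set set \<Rightarrow> 'p" where
  "ext_lift R P f = quot_lift (tensor_lift R P f)"

definition sym_rels ::
  "('r, 'q) ring_scheme \<Rightarrow> ('r, 'g, 'e) module_scheme \<Rightarrow> ('g list \<Rightarrow> 'r) set set" where
  "sym_rels R L =
    {tensor R L [x, y] \<ominus>\<^bsub>tensor_power R L 2\<^esub> tensor R L [y, x]
      | x y. x \<in> carrier L \<and> y \<in> carrier L}"

definition sym_square ::
  "('r, 'q) ring_scheme \<Rightarrow> ('r, 'g, 'e) module_scheme \<Rightarrow> ('r, ('g list \<Rightarrow> 'r) set set) module" where
  "sym_square R L =
    quot_module (tensor_power R L 2) (submod_span R (tensor_power R L 2) (sym_rels R L))"

definition sym_prod ::
  "('r, 'q) ring_scheme \<Rightarrow> ('r, 'g, 'e) module_scheme \<Rightarrow> 'g \<Rightarrow> 'g \<Rightarrow> ('g list \<Rightarrow> 'r) set set" where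
  "sym_prod R L x y =
    submod_span R (tensor_power R L 2) (sym_rels R L) +>\<^bsub>tensor_power R L 2\<^esub> tensor R L [x, y]"


section \<open>Lie algebras and their homology\<close>

locale lie_algebra = module R L
  for R :: "('r, 'q) ring_scheme" (structure) and L :: "('r, 'g, 'e) module_scheme" (structure) +
  fixes br :: "'g \<Rightarrow> 'g \<Rightarrow> 'g"
  assumes br_closed: "\<lbrakk>x \<in> carrier L; y \<in> carrier L\<rbrakk> \<Longrightarrow> br x y \<in> carrier L"
    and br_add_left: "\<lbrakk>x \<in> carrier L; y \<in> carrier L; z \<in> carrier L\<rbrakk>
      \<Longrightarrow> br (x \<oplus>\<^bsub>L\<^esub> y) z = br x z \<oplus>\<^bsub>L\<^esub> br y z"
    and br_add_right: "\<lbrakk>x \<in> carrier L; y \<in> carrier L; z \<in> carrier L\<rbrakk>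
      \<Longrightarrow> br x (y \<oplus>\<^bsub>L\<^esub> z) = br x y \<oplus>\<^bsub>L\<^esub> br x z"
    and br_smult_left: "\<lbrakk>a \<in> carrier R; x \<in> carrier L; y \<in> carrier L\<rbrakk>
      \<Longrightarrow> br (a \<odot>\<^bsub>L\<^esub> x) y = a \<odot>\<^bsub>L\<^esub> br x y"
    and br_smult_right: "\<lbrakk>a \<in> carrier R; x \<in> carrier L; y \<in> carrier L\<rbrakk>
      \<Longrightarrow> br x (a \<odot>\<^bsub>L\<^esub> y) = a \<odot>\<^bsub>L\<^esub> br x y"
    and br_alternating: "x \<in> carrier L \<Longrightarrow> br x x = \<zero>\<^bsub>L\<^esub>"
    and br_jacobi: "\<lbrakk>x \<in> carrier L; y \<in> carrier L; z \<in> carrier L\<rbrakk>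
      \<Longrightarrow> br x (br y z) \<oplus>\<^bsub>L\<^esub> br y (br z x) \<oplus>\<^bsub>L\<^esub> br z (br x y) = \<zero>\<^bsub>L\<^esub>"

text \<open>Lists are indexed from \<open>0\<close>; the sign \<open>(- 1) ^ (i + j)\<close> is the same for indexing from \<open>1\<close>.\<close>

definition ce_boundary ::
  "('r, 'q) ring_scheme \<Rightarrow> ('r, 'g, 'e) module_scheme \<Rightarrow> ('g \<Rightarrow> 'g \<Rightarrow> 'g) \<Rightarrow> nat \<Rightarrow>
    ('g list \<Rightarrow> 'r) set set \<Rightarrow> ('g list \<Rightarrow> 'r) set set" where
  "ce_boundary R L br n =
    ext_lift R (ext_power R L (n - 1))
      (\<lambda>xs. finsum (ext_power R L (n - 1))
        (\<lambda>(i, j). ((\<ominus>\<^bsub>R\<^esub> \<one>\<^bsub>R\<^esub>) [^]\<^bsub>R\<^esub> (i + j)) \<odot>\<^bsub>ext_power R L (n - 1)\<^esub>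
                   wedge R L (br (xs ! i) (xs ! j) # nths xs (- {i, j})))
        {(i, j). i < j \<and> j < n})"

definition ce_cycles ::
  "('r, 'q) ring_scheme \<Rightarrow> ('r, 'g, 'e) module_scheme \<Rightarrow> ('g \<Rightarrow> 'g \<Rightarrow> 'g) \<Rightarrow> nat \<Rightarrow>
    ('g list \<Rightarrow> 'r) set set set" where
  "ce_cycles R L br n =
    a_kernel (ext_power R L n) (ext_power R L (n - 1)) (ce_boundary R L br n)"

definition ce_boundaries ::
  "('r, 'q) ring_scheme \<Rightarrow> ('r, 'g, 'e) module_scheme \<Rightarrow> ('g \<Rightarrow> 'g \<Rightarrow> 'g) \<Rightarrow> nat \<Rightarrow>
    ('g list \<Rightarrow> 'r) set set set" where
  "ce_boundaries R L br n = ce_boundary R L br (Suc n) ` carrier (ext_power R L (Suc n))"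

definition ce_homology ::
  "('r, 'q) ring_scheme \<Rightarrow> ('r, 'g, 'e) module_scheme \<Rightarrow> ('g \<Rightarrow> 'g \<Rightarrow> 'g) \<Rightarrow> nat \<Rightarrow>
    ('r, ('g list \<Rightarrow> 'r) set set set) module" where
  "ce_homology R L br n =
    quot_module (ext_power R L n\<lparr>carrier := ce_cycles R L br n\<rparr>) (ce_boundaries R L br n)"


section \<open>The Killing module and the Koszul map\<close>

definition kill_rel_map ::
  "('r, 'q) ring_scheme \<Rightarrow> ('r, 'g, 'e) module_scheme \<Rightarrow> ('g \<Rightarrow> 'g \<Rightarrow> 'g) \<Rightarrow>
    ('g list \<Rightarrow> 'r) set \<Rightarrow> ('g list \<Rightarrow> 'r) set set" where
  "kill_rel_map R L br =
    tensor_lift R (sym_square R L)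
      (\<lambda>xs. sym_prod R L (br (xs ! 0) (xs ! 1)) (xs ! 2)
            \<ominus>\<^bsub>sym_square R L\<^esub> sym_prod R L (xs ! 0) (br (xs ! 1) (xs ! 2)))"

definition killing_module ::
  "('r, 'q) ring_scheme \<Rightarrow> ('r, 'g, 'e) module_scheme \<Rightarrow> ('g \<Rightarrow> 'g \<Rightarrow> 'g) \<Rightarrow>
    ('r, ('g list \<Rightarrow> 'r) set set set) module" where
  "killing_module R L br =
    quot_module (sym_square R L) (kill_rel_map R L br ` carrier (tensor_power R L 3))"

definition koszul_map ::
  "('r, 'q) ring_scheme \<Rightarrow> ('r, 'g, 'e) module_scheme \<Rightarrow> ('g \<Rightarrow> 'g \<Rightarrow> 'g) \<Rightarrow>
    ('g list \<Rightarrow> 'r) set set \<Rightarrow> ('g list \<Rightarrow> 'r) set set set" where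
  "koszul_map R L br =
    ext_lift R (killing_module R L br)
      (\<lambda>xs. kill_rel_map R L br ` carrier (tensor_power R L 3)
            +>\<^bsub>sym_square R L\<^esub> sym_prod R L (xs ! 0) (br (xs ! 1) (xs ! 2)))"

definition reduced_koszul_map ::
  "('r, 'q) ring_scheme \<Rightarrow> ('r, 'g, 'e) module_scheme \<Rightarrow> ('g \<Rightarrow> 'g \<Rightarrow> 'g) \<Rightarrow>
    ('g list \<Rightarrow> 'r) set set set \<Rightarrow> ('g list \<Rightarrow> 'r) set set set" where
  "reduced_koszul_map R L br = quot_lift (koszul_map R L br)"


section \<open>Gradings\<close>

text \<open>The grading group \<open>A\<close> is written multiplicatively, so degree \<open>0\<close> is \<open>\<one>\<^bsub>A\<^esub>\<close>. The assumption
  \<open>direct_sum\<close> says that every element has exactly one finitely supported family of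
  homogeneous components.\<close>

locale graded_lie_algebra = lie_algebra R L br + A: comm_group A
  for R :: "('r, 'q) ring_scheme" (structure) and L :: "('r, 'g, 'e) module_scheme" (structure)
    and br :: "'g \<Rightarrow> 'g \<Rightarrow> 'g" and A :: "('a, 'f) monoid_scheme" (structure) +
  fixes Gr :: "'a \<Rightarrow> 'g set"
  assumes graded_submodule: "\<alpha> \<in> carrier A \<Longrightarrow> submodule (Gr \<alpha>) R L"
    and direct_sum: "x \<in> carrier L \<Longrightarrow>
      \<exists>!u. (\<forall>\<alpha>\<in>carrier A. u \<alpha> \<in> Gr \<alpha>) \<and> (\<forall>\<alpha>. \<alpha> \<notin> carrier A \<longrightarrow> u \<alpha> = \<zero>\<^bsub>L\<^esub>)
           \<and> finite {\<alpha>. u \<alpha> \<noteq> \<zero>\<^bsub>L\<^esub>} \<and> x = (\<Oplus>\<^bsub>L\<^esub>\<alpha>\<in>{\<alpha>. u \<alpha> \<noteq> \<zero>\<^bsub>L\<^esub>}. u \<alpha>)"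
    and br_graded: "\<lbrakk>\<alpha> \<in> carrier A; \<beta> \<in> carrier A; x \<in> Gr \<alpha>; y \<in> Gr \<beta>\<rbrakk>
      \<Longrightarrow> br x y \<in> Gr (\<alpha> \<otimes>\<^bsub>A\<^esub> \<beta>)"

definition ext_power_deg ::
  "('r, 'q) ring_scheme \<Rightarrow> ('r, 'g, 'e) module_scheme \<Rightarrow> ('a, 'f) monoid_scheme \<Rightarrow> ('a \<Rightarrow> 'g set) \<Rightarrow>
    nat \<Rightarrow> 'a \<Rightarrow> ('g list \<Rightarrow> 'r) set set set" where
  "ext_power_deg R L A Gr n \<alpha> =
    submod_span R (ext_power R L n)
      {wedge R L xs | xs \<alpha>s. length xs = n \<and> set \<alpha>s \<subseteq> carrier A
         \<and> list_all2 (\<lambda>x \<beta>. x \<in> Gr \<beta>) xs \<alpha>s \<and> foldr (\<otimes>\<^bsub>A\<^esub>) \<alpha>s \<one>\<^bsub>A\<^esub> = \<alpha>}"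

text \<open>The degree-\<open>\<alpha>\<close> part of homology consists of the classes of the cycles of degree \<open>\<alpha>\<close>.\<close>

definition ce_homology_deg ::
  "('r, 'q) ring_scheme \<Rightarrow> ('r, 'g, 'e) module_scheme \<Rightarrow> ('g \<Rightarrow> 'g \<Rightarrow> 'g) \<Rightarrow>
    ('a, 'f) monoid_scheme \<Rightarrow> ('a \<Rightarrow> 'g set) \<Rightarrow> nat \<Rightarrow> 'a \<Rightarrow> ('g list \<Rightarrow> 'r) set set set set" where
  "ce_homology_deg R L br A Gr n \<alpha> =
    (\<lambda>c. ce_boundaries R L br n +>\<^bsub>ext_power R L n\<^esub> c)
      ` (ce_cycles R L br n \<inter> ext_power_deg R L A Gr n \<alpha>)"

end

theory Submission
  imports Defs
begin

text \<open>Let \<open>B : \<gg> \<times> \<gg> \<rightarrow> Kill(\<gg>)\<close> be the universal invariant symmetric bilinear form, so that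
  \<open>\<eta>(x \<and> y \<and> z) = B(x, [y, z])\<close>. Multiplying \<open>\<gg>\<^sub>\<alpha>\<close> by the scalar \<open>\<phi>(\<alpha>)\<close> is a derivation \<open>D\<close>
  of \<open>\<gg>\<close>, because \<open>\<phi>\<close> is additive. The form \<open>\<omega>(x, y) = B(x, D y) - B(D x, y)\<close> is alternating,
  and invariance of \<open>B\<close> gives \<open>\<omega> \<circ> \<partial>\<^sub>3 = \<eta> \<circ> D\<close>, where \<open>D\<close> acts on \<open>\<Lambda>\<^sup>3\<gg>\<close> as a derivation and hence
  on its part of degree \<open>\<alpha>\<close> as the scalar \<open>\<phi>(\<alpha>)\<close>. So \<open>\<phi>(\<alpha>) \<eta>(z) = \<omega>(\<partial>\<^sub>3 z) = 0\<close> for every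
  cycle \<open>z\<close> of degree \<open>\<alpha>\<close>, and \<open>\<phi>(\<alpha>)\<close> is invertible if \<open>\<alpha> \<noteq> 0\<close>.\<close>


section \<open>Linear maps and quotient modules\<close>

text \<open>When a derivation \<open>D\<close> is skew for \<open>B\<close>, the form
  \<open>B(x, D y)\<close> is the classical 2-cocycle attached to it. The weight derivation is in
  general not skew, so \<open>B(x, D y)\<close> is antisymmetrised into \<open>\<omega>\<close>,
  which need no longer vanish on 2-boundaries: its defect is
  \<open>B(D x, [y, z]) + B(x, D [y, z])\<close>, that is, \<open>\<eta>\<close> after
  \<open>D\<close>. No factor 1/2 enters, since the symmetry of \<open>B\<close> alone gives
  \<open>\<omega>(x, x) = 0\<close>. The obstacle is formal. Exterior powers and the Killing module
  are iterated quotients of a free module, and maps out of a quotient are read off by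
  \<open>the_elem\<close>, so a formula on wedges has no meaning until it is known to be multilinear
  and alternating. This is established for \<open>\<eta>\<close>, for \<open>\<omega>\<close> and
  for the boundary in degrees 3 and 4; degree 4 enters because \<open>\<eta>\<close> must vanish on
  3-boundaries to be defined on classes. Identities between the resulting linear maps are then
  checked on wedges, and in degree \<alpha> on wedges of homogeneous vectors. The subfield matters
  because a nonzero element of \<open>R\<close> itself could be a zero divisor, while a nonzero
  element of \<open>K\<close> has an inverse.\<close>

lemma (in abelian_group) conjugate_cancel:
  assumes "x \<in> carrier G" "y \<in> carrier G"
  shows "y \<oplus> (x \<oplus> \<ominus> y) = x" "\<ominus> y \<oplus> (x \<oplus> y) = x"
proof -
  have "y \<oplus> (x \<oplus> \<ominus> y) = x \<oplus> (y \<oplus> \<ominus> y)" "\<ominus> y \<oplus> (x \<oplus> y) = x \<oplus> (\<ominus> y \<oplus> y)"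
    using assms by (simp_all only: a_lcomm a_inv_closed)
  then show "y \<oplus> (x \<oplus> \<ominus> y) = x" "\<ominus> y \<oplus> (x \<oplus> y) = x"
    using assms by (simp_all add: l_neg r_neg)
qed

lemma (in abelian_group) neg_zero: "\<ominus> \<zero> = \<zero>"
  by (rule minus_equality) simp_all

text \<open>The coefficients in \<open>\<omega> \<circ> \<partial>\<^sub>3 = \<eta> \<circ> D\<close>: \<open>p\<close>, \<open>q\<close>, \<open>r\<close> are the weights of the three
  vectors, times \<open>B(x, [y, z])\<close>.\<close>

lemma (in abelian_group) cyclic_cancel:
  assumes "p \<in> carrier G" "q \<in> carrier G" "r \<in> carrier G"
  shows "\<ominus> (r \<oplus> \<ominus> (p \<oplus> q)) \<oplus> ((\<ominus> q \<oplus> (p \<oplus> r)) \<oplus> \<ominus> (p \<oplus> \<ominus> (q \<oplus> r))) = p \<oplus> (q \<oplus> r)"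
proof -
  have "(\<ominus> q \<oplus> (p \<oplus> r)) \<oplus> (\<ominus> p \<oplus> (q \<oplus> r)) = ((r \<oplus> p) \<oplus> \<ominus> q) \<oplus> (q \<oplus> (\<ominus> p \<oplus> r))"
    using assms by (metis a_comm a_lcomm a_closed a_inv_closed)
  also have "\<dots> = r \<oplus> r"
    using assms by (simp add: a_assoc r_neg1 r_neg2)
  finally have *: "(\<ominus> q \<oplus> (p \<oplus> r)) \<oplus> (\<ominus> p \<oplus> (q \<oplus> r)) = r \<oplus> r" .
  have "\<ominus> (r \<oplus> \<ominus> (p \<oplus> q)) \<oplus> ((\<ominus> q \<oplus> (p \<oplus> r)) \<oplus> \<ominus> (p \<oplus> \<ominus> (q \<oplus> r)))
      = (\<ominus> r \<oplus> (p \<oplus> q)) \<oplus> ((\<ominus> q \<oplus> (p \<oplus> r)) \<oplus> (\<ominus> p \<oplus> (q \<oplus> r)))"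
    using assms by (simp only: minus_add minus_minus a_closed a_inv_closed)
  also have "\<dots> = ((p \<oplus> q) \<oplus> \<ominus> r) \<oplus> (r \<oplus> r)"
    unfolding * using assms by (simp only: a_comm a_closed a_inv_closed)
  also have "\<dots> = p \<oplus> (q \<oplus> r)"
    using assms by (simp add: a_assoc r_neg1)
  finally show ?thesis .
qed

locale linear_map = M: module R M + P: module R P
  for R :: "('r, 'q) ring_scheme" (structure)
    and M :: "('r, 'm, 'e) module_scheme" and P :: "('r, 'p, 'd) module_scheme" +
  fixes h :: "'m \<Rightarrow> 'p"
  assumes hom_closed: "x \<in> carrier M \<Longrightarrow> h x \<in> carrier P"
    and hom_add: "\<lbrakk>x \<in> carrier M; y \<in> carrier M\<rbrakk> \<Longrightarrow> h (x \<oplus>\<^bsub>M\<^esub> y) = h x \<oplus>\<^bsub>P\<^esub> h y"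
    and hom_smult: "\<lbrakk>a \<in> carrier R; x \<in> carrier M\<rbrakk> \<Longrightarrow> h (a \<odot>\<^bsub>M\<^esub> x) = a \<odot>\<^bsub>P\<^esub> h x"
begin

lemma hom_zero: "h \<zero>\<^bsub>M\<^esub> = \<zero>\<^bsub>P\<^esub>"
  using hom_smult[of \<zero> "\<zero>\<^bsub>M\<^esub>"] hom_closed by simp

lemma hom_neg: "x \<in> carrier M \<Longrightarrow> h (\<ominus>\<^bsub>M\<^esub> x) = \<ominus>\<^bsub>P\<^esub> h x"
  using hom_add[of "\<ominus>\<^bsub>M\<^esub> x" x] hom_closed
  by (metis M.M.add.inv_closed M.M.l_neg P.M.minus_equality hom_zero)

lemma hom_minus:
  "\<lbrakk>x \<in> carrier M; y \<in> carrier M\<rbrakk> \<Longrightarrow> h (x \<ominus>\<^bsub>M\<^esub> y) = h x \<ominus>\<^bsub>P\<^esub> h y"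
  by (simp add: a_minus_def hom_add hom_neg)

lemma image_submodule: "submodule (h ` carrier M) R P"
proof (rule P.submoduleI)
  show "\<zero>\<^bsub>P\<^esub> \<in> h ` carrier M"
    using hom_zero by (metis M.M.zero_closed image_eqI)
next
  fix a assume "a \<in> h ` carrier M" then show "\<ominus>\<^bsub>P\<^esub> a \<in> h ` carrier M"
    using hom_neg by (metis (no_types, lifting) M.M.a_inv_closed image_iff)
next
  fix a b assume "a \<in> h ` carrier M" "b \<in> h ` carrier M"
  then show "a \<oplus>\<^bsub>P\<^esub> b \<in> h ` carrier M"
    using hom_add by (metis (no_types, lifting) M.M.a_closed image_iff)
next
  fix a x assume "a \<in> carrier R" "x \<in> h ` carrier M"
  then show "a \<odot>\<^bsub>P\<^esub> x \<in> h ` carrier M"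
    using hom_smult by (metis (no_types, lifting) M.smult_closed image_iff)
qed (use hom_closed in auto)

end

text \<open>The source of the uniqueness statements below: once two linear maps agree on generators,
  the equalizer is a submodule containing these generators, hence everything they generate.\<close>

lemma equalizer_submodule:
  assumes "linear_map R M P h" "linear_map R M P k"
  shows "submodule {x \<in> carrier M. h x = k x} R M"
proof -
  interpret h: linear_map R M P h by fact
  interpret k: linear_map R M P k by fact
  show ?thesis
    by (rule h.M.submoduleI)
      (auto simp: h.hom_zero k.hom_zero h.hom_neg k.hom_neg h.hom_add k.hom_add
        h.hom_smult k.hom_smult)
qed

context module
begin

lemma linear_map_zero:
  assumes "module R P" shows "linear_map R M P (\<lambda>_. \<zero>\<^bsub>P\<^esub>)"
proof -
  interpret P: module R P by fact
  show ?thesis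
    by unfold_locales auto
qed

lemma submodule_zero: "submodule N R M \<Longrightarrow> \<zero>\<^bsub>M\<^esub> \<in> N"
  using submodule.axioms(1) subgroup.one_closed by fastforce

lemma submod_span_submodule:
  assumes "S \<subseteq> carrier M"
  shows "submodule (submod_span R M S) R M"
proof (rule submoduleI)
  \<comment> \<open>\<open>carrier M\<close> is itself a submodule over \<open>S\<close>. If there
    were none, the hull would be an empty intersection, that is, the whole type.\<close>
  show "submod_span R M S \<subseteq> carrier M"
    unfolding submod_span_def using assms carrier_is_submodule by (rule hull_minimal)
qed (auto simp: submod_span_def hull_def intro: submodule_zero submoduleE)

lemma submod_span_minimal: "\<lbrakk>S \<subseteq> N; submodule N R M\<rbrakk> \<Longrightarrow> submod_span R M S \<subseteq> N"
  unfolding submod_span_def by (rule hull_minimal)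

lemma submod_span_superset: "S \<subseteq> submod_span R M S"
  unfolding submod_span_def by (rule hull_subset)

end

lemma linear_map_eq_on_span:
  assumes "linear_map R M P h" "linear_map R M P k"
    and "S \<subseteq> carrier M" "\<And>x. x \<in> S \<Longrightarrow> h x = k x" "x \<in> submod_span R M S"
  shows "h x = k x"
proof -
  interpret linear_map R M P h by fact
  have "submod_span R M S \<subseteq> {x \<in> carrier M. h x = k x}"
    by (rule M.submod_span_minimal) (use assms equalizer_submodule in auto)
  with assms(5) show ?thesis by auto
qed

lemma linear_map_comp:
  assumes "linear_map R M P h" "linear_map R P Q k"
  shows "linear_map R M Q (\<lambda>x. k (h x))"
proof -
  interpret h: linear_map R M P h by fact
  interpret k: linear_map R P Q k by fact
  show ?thesis
    by unfold_locales (simp_all add: h.hom_closed k.hom_closed h.hom_add k.hom_add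
        h.hom_smult k.hom_smult)
qed

lemma linear_map_diff:
  assumes "linear_map R M P h" "linear_map R M P k"
  shows "linear_map R M P (\<lambda>x. h x \<ominus>\<^bsub>P\<^esub> k x)"
proof -
  interpret h: linear_map R M P h by fact
  interpret k: linear_map R M P k by fact
  show ?thesis
    by unfold_locales
      (simp_all add: a_minus_def h.hom_closed k.hom_closed h.hom_add k.hom_add h.hom_smult
        k.hom_smult h.P.smult_r_distr h.P.smult_r_minus h.P.M.minus_add h.P.M.a_ac)
qed

lemma (in module) linear_map_scale: "a \<in> carrier R \<Longrightarrow> linear_map R M M (\<lambda>x. a \<odot>\<^bsub>M\<^esub> x)"
  by unfold_locales (simp_all add: smult_r_distr smult_assoc1[symmetric] R.m_comm)

section \<open>Quotients of a module by a submodule and maps out of them\<close>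

locale quotient_module = module R M + submodule N R M
  for R :: "('r, 'q) ring_scheme" (structure)
    and M :: "('r, 'm, 'e) module_scheme" and N
begin

lemma abelian_subgroup: "abelian_subgroup N M"
  by (rule abelian_subgroupI3)
    (simp_all add: additive_subgroup_def subgroup_axioms M.abelian_group_axioms)

sublocale Q: abelian_subgroup N M
  by (rule abelian_subgroup)

abbreviation Q where "Q \<equiv> quot_module M N"

lemma carrier_quot: "carrier Q = (\<lambda>x. N +>\<^bsub>M\<^esub> x) ` carrier M"
  by (auto simp: quot_module_def A_RCOSETS_def')

lemma zero_quot: "\<zero>\<^bsub>Q\<^esub> = N +>\<^bsub>M\<^esub> \<zero>\<^bsub>M\<^esub>"
  using Q.a_subset by (simp add: quot_module_def)

lemma add_quot: "\<lbrakk>x \<in> carrier M; y \<in> carrier M\<rbrakk>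
    \<Longrightarrow> (N +>\<^bsub>M\<^esub> x) \<oplus>\<^bsub>Q\<^esub> (N +>\<^bsub>M\<^esub> y) = N +>\<^bsub>M\<^esub> (x \<oplus>\<^bsub>M\<^esub> y)"
  by (simp add: quot_module_def Q.a_rcos_sum)

lemma coset_eq_iff:
  assumes "x \<in> carrier M" "y \<in> carrier M"
  shows "N +>\<^bsub>M\<^esub> x = N +>\<^bsub>M\<^esub> y \<longleftrightarrow> x \<ominus>\<^bsub>M\<^esub> y \<in> N"
proof
  assume "N +>\<^bsub>M\<^esub> x = N +>\<^bsub>M\<^esub> y"
  then have "x \<in> N +>\<^bsub>M\<^esub> y" using Q.a_rcos_self[OF assms(1)] by simp
  then show "x \<ominus>\<^bsub>M\<^esub> y \<in> N"
    using Q.a_rcos_module_imp[OF assms(2)] by (simp add: a_minus_def)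
next
  assume "x \<ominus>\<^bsub>M\<^esub> y \<in> N"
  then have "x \<in> N +>\<^bsub>M\<^esub> y"
    using Q.a_rcos_module_rev[OF assms(2,1)] by (simp add: a_minus_def)
  then show "N +>\<^bsub>M\<^esub> x = N +>\<^bsub>M\<^esub> y"
    using Q.a_repr_independence'[OF _ assms(2)] by simp
qed

text \<open>The scalar multiple in \<open>quot_module\<close> is a union over all representatives of
  the coset. Differences of representatives lie in \<open>N\<close>, which is stable under
  \<open>a\<close>, so the union is over a nonempty family of equal cosets.\<close>

lemma smult_quot:
  assumes "a \<in> carrier R" "x \<in> carrier M"
  shows "a \<odot>\<^bsub>Q\<^esub> (N +>\<^bsub>M\<^esub> x) = N +>\<^bsub>M\<^esub> (a \<odot>\<^bsub>M\<^esub> x)"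
proof -
  have "N +>\<^bsub>M\<^esub> (a \<odot>\<^bsub>M\<^esub> y) = N +>\<^bsub>M\<^esub> (a \<odot>\<^bsub>M\<^esub> x)" if "y \<in> N +>\<^bsub>M\<^esub> x" for y
  proof -
    have y: "y \<in> carrier M"
      using Q.a_elemrcos_carrier[OF assms(2) that] .
    have "y \<ominus>\<^bsub>M\<^esub> x \<in> N"
      using Q.a_rcos_module_imp[OF assms(2) that] by (simp add: a_minus_def)
    then have "a \<odot>\<^bsub>M\<^esub> (y \<ominus>\<^bsub>M\<^esub> x) \<in> N" using assms(1) by simp
    then have "a \<odot>\<^bsub>M\<^esub> y \<ominus>\<^bsub>M\<^esub> a \<odot>\<^bsub>M\<^esub> x \<in> N"
      using assms y by (simp add: a_minus_def smult_r_distr smult_r_minus)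
    then show ?thesis using assms y by (simp add: coset_eq_iff)
  qed
  then have "(\<Union>y\<in>N +>\<^bsub>M\<^esub> x. N +>\<^bsub>M\<^esub> (a \<odot>\<^bsub>M\<^esub> y)) = (\<Union>y\<in>N +>\<^bsub>M\<^esub> x. N +>\<^bsub>M\<^esub> (a \<odot>\<^bsub>M\<^esub> x))"
    by (rule SUP_cong[OF refl])
  moreover have "N +>\<^bsub>M\<^esub> x \<noteq> {}"
    using Q.a_rcos_self[OF assms(2)] by blast
  ultimately show ?thesis
    by (simp add: quot_module_def)
qed

lemma module_quot: "module R Q"
proof (rule moduleI)
  show "cring R" by unfold_locales
  show "abelian_group Q"
  proof (rule abelian_groupI)
    fix x assume "x \<in> carrier Q"
    then obtain u where u: "u \<in> carrier M" "x = N +>\<^bsub>M\<^esub> u" by (auto simp: carrier_quot)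
    show "\<exists>y\<in>carrier Q. y \<oplus>\<^bsub>Q\<^esub> x = \<zero>\<^bsub>Q\<^esub>"
      by (rule bexI[of _ "N +>\<^bsub>M\<^esub> (\<ominus>\<^bsub>M\<^esub> u)"])
        (use u in \<open>auto simp: add_quot zero_quot carrier_quot M.l_neg\<close>)
  qed (auto simp: carrier_quot zero_quot add_quot M.a_ac)
qed (auto simp: carrier_quot add_quot smult_quot smult_l_distr smult_r_distr smult_assoc1)

lemma proj_linear: "linear_map R M Q (\<lambda>x. N +>\<^bsub>M\<^esub> x)"
proof -
  interpret Q': module R Q by (rule module_quot)
  show ?thesis
    by unfold_locales (auto simp: add_quot smult_quot carrier_quot)
qed

lemma proj_eq_zero: "x \<in> N \<Longrightarrow> N +>\<^bsub>M\<^esub> x = \<zero>\<^bsub>Q\<^esub>"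
  by (simp add: quot_module_def Q.a_rcos_const)

text \<open>\<open>the_elem\<close> yields the right value because the image of the coset is a
  singleton: \<open>h\<close> kills \<open>N\<close>, so it is constant on the coset, and the coset
  contains \<open>x\<close>.\<close>

lemma quot_lift_proj:
  assumes "linear_map R M P h" "\<And>x. x \<in> N \<Longrightarrow> h x = \<zero>\<^bsub>P\<^esub>" "x \<in> carrier M"
  shows "quot_lift h (N +>\<^bsub>M\<^esub> x) = h x"
proof -
  interpret h: linear_map R M P h by fact
  have "h y = h x" if y: "y \<in> N +>\<^bsub>M\<^esub> x" for y
  proof -
    obtain n where "n \<in> N" "y = n \<oplus>\<^bsub>M\<^esub> x" using y by (auto simp: a_r_coset_def')
    moreover from this have "n \<in> carrier M" using Q.a_subset by auto
    ultimately show ?thesis using assms(2,3) by (simp add: h.hom_add h.hom_closed)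
  qed
  then have "h ` (N +>\<^bsub>M\<^esub> x) = (\<lambda>_. h x) ` (N +>\<^bsub>M\<^esub> x)"
    by (rule image_cong[OF refl])
  moreover have "N +>\<^bsub>M\<^esub> x \<noteq> {}"
    using Q.a_rcos_self[OF assms(3)] by blast
  ultimately have "h ` (N +>\<^bsub>M\<^esub> x) = {h x}"
    by (simp add: image_constant_conv)
  then show ?thesis by (simp add: quot_lift_def)
qed

lemma quot_lift_linear:
  assumes "linear_map R M P h" "\<And>x. x \<in> N \<Longrightarrow> h x = \<zero>\<^bsub>P\<^esub>"
  shows "linear_map R Q P (quot_lift h)"
proof -
  interpret h: linear_map R M P h by fact
  interpret Q': module R Q by (rule module_quot)
  show ?thesis
    by unfold_locales
      (auto simp: carrier_quot add_quot smult_quot quot_lift_proj[OF assms]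
        h.hom_closed h.hom_add h.hom_smult)
qed

lemma linear_map_quot_eqI:
  assumes "linear_map R Q P h" "linear_map R Q P k"
    and "\<And>x. x \<in> carrier M \<Longrightarrow> h (N +>\<^bsub>M\<^esub> x) = k (N +>\<^bsub>M\<^esub> x)" "X \<in> carrier Q"
  shows "h X = k X"
  using assms by (auto simp: carrier_quot)

end

lemma (in module) quotient_module_span:
  "S \<subseteq> carrier M \<Longrightarrow> quotient_module R M (submod_span R M S)"
  by (intro quotient_module.intro module_axioms submod_span_submodule)

lemma linear_map_zero_on_span:
  assumes "linear_map R M P h" "S \<subseteq> carrier M" "\<And>s. s \<in> S \<Longrightarrow> h s = \<zero>\<^bsub>P\<^esub>"
    and "x \<in> submod_span R M S"
  shows "h x = \<zero>\<^bsub>P\<^esub>"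
proof -
  interpret linear_map R M P h by fact
  show ?thesis
    by (rule linear_map_eq_on_span[OF assms(1) M.linear_map_zero[OF P.module_axioms] assms(2,3,4)])
qed


section \<open>Free modules\<close>

context cring
begin

lemma free_module_add: "c \<oplus>\<^bsub>free_module R B\<^esub> d = (\<lambda>x. c x \<oplus> d x)"
  and free_module_smult: "a \<odot>\<^bsub>free_module R B\<^esub> c = (\<lambda>x. a \<otimes> c x)"
  and free_module_zero: "\<zero>\<^bsub>free_module R B\<^esub> = (\<lambda>_. \<zero>)"
  by (simp_all add: free_module_def)

lemma free_module_carrier: "c \<in> carrier (free_module R B) \<longleftrightarrow>
    (\<forall>x. c x \<in> carrier R) \<and> {x. c x \<noteq> \<zero>} \<subseteq> B \<and> finite {x. c x \<noteq> \<zero>}"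
  by (auto simp: free_module_def)

lemma free_module_carrierI:
  assumes "\<And>x. c x \<in> carrier R" "finite T" "T \<subseteq> B" "\<And>x. x \<notin> T \<Longrightarrow> c x = \<zero>"
  shows "c \<in> carrier (free_module R B)"
proof -
  have "{x. c x \<noteq> \<zero>} \<subseteq> T" using assms(4) by auto
  then show ?thesis using assms(1-3) by (auto simp: free_module_carrier intro: finite_subset)
qed

lemma module_free_module: "module R (free_module R B)"
proof (rule moduleI)
  let ?F = "free_module R B"
  have add: "(\<lambda>x. c x \<oplus> d x) \<in> carrier ?F" if "c \<in> carrier ?F" "d \<in> carrier ?F" for c d
    by (rule free_module_carrierI[of _ "{x. c x \<noteq> \<zero>} \<union> {x. d x \<noteq> \<zero>}"])
      (use that in \<open>auto simp: free_module_carrier\<close>)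
  have sm: "(\<lambda>x. a \<otimes> c x) \<in> carrier ?F" if "c \<in> carrier ?F" "a \<in> carrier R" for a c
    by (rule free_module_carrierI[of _ "{x. c x \<noteq> \<zero>}"])
      (use that in \<open>auto simp: free_module_carrier\<close>)
  show "abelian_group ?F"
  proof (rule abelian_groupI)
    fix c assume c: "c \<in> carrier ?F"
    have "(\<lambda>x. \<ominus> c x) \<in> carrier ?F"
      by (rule free_module_carrierI[of _ "{x. c x \<noteq> \<zero>}"])
        (use c in \<open>auto simp: free_module_carrier\<close>)
    then show "\<exists>d\<in>carrier ?F. d \<oplus>\<^bsub>?F\<^esub> c = \<zero>\<^bsub>?F\<^esub>"
      by (rule bexI[rotated])
        (use c in \<open>auto simp: free_module_add free_module_zero free_module_carrier l_neg\<close>)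
  qed (auto simp: free_module_add free_module_zero add, auto simp: free_module_carrier a_ac)
  show "a \<odot>\<^bsub>?F\<^esub> c \<in> carrier ?F" if "a \<in> carrier R" "c \<in> carrier ?F" for a c
    using sm that by (simp add: free_module_smult)
qed (auto simp: free_module_add free_module_smult free_module_carrier is_cring l_distr r_distr m_assoc)

lemma free_gen_closed: "x \<in> B \<Longrightarrow> free_gen R x \<in> carrier (free_module R B)"
  by (rule free_module_carrierI[of _ "{x}"]) (auto simp: free_gen_def)

text \<open>The induction runs over a finite set containing the support rather than over the support
  itself. The step either finds the coordinate at \<open>x\<close> already zero, or splits
  \<open>c\<close> into \<open>c(x := \<zero>)\<close> and a multiple of the generator at
  \<open>x\<close>.\<close>

lemma free_module_induct:
  assumes N: "submodule N R (free_module R B)" and gen: "\<And>x. x \<in> B \<Longrightarrow> free_gen R x \<in> N"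
    and c: "c \<in> carrier (free_module R B)"
  shows "c \<in> N"
proof -
  let ?F = "free_module R B"
  interpret F: module R ?F by (rule module_free_module)
  have "c \<in> N" if "finite T" "c \<in> carrier ?F" "{x. c x \<noteq> \<zero>} \<subseteq> T" for c T
    using that
  proof (induction T arbitrary: c rule: finite_induct)
    case empty
    then have "c = \<zero>\<^bsub>?F\<^esub>" by (auto simp: free_module_zero)
    then show ?case using F.submodule_zero[OF N] by simp
  next
    case (insert x T)
    show ?case
    proof (cases "c x = \<zero>")
      case True
      then show ?thesis using insert by (metis (mono_tags, lifting) mem_Collect_eq subset_insert)
    next
      case False
      let ?d = "c(x := \<zero>)"
      have x: "x \<in> B" using False insert.prems by (auto simp: free_module_carrier)
      have "?d \<in> carrier ?F"
        by (rule free_module_carrierI[of _ "{x. c x \<noteq> \<zero>}"])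
          (use insert.prems in \<open>auto simp: free_module_carrier\<close>)
      moreover have "{y. ?d y \<noteq> \<zero>} \<subseteq> T" using insert.prems by auto
      ultimately have "?d \<in> N" by (rule insert.IH)
      moreover have "c x \<in> carrier R" using insert.prems by (simp add: free_module_carrier)
      ultimately have "?d \<oplus>\<^bsub>?F\<^esub> c x \<odot>\<^bsub>?F\<^esub> free_gen R x \<in> N"
        using F.submoduleE[OF N] gen[OF x] by metis
      moreover have "?d \<oplus>\<^bsub>?F\<^esub> c x \<odot>\<^bsub>?F\<^esub> free_gen R x = c"
        using insert.prems by (auto simp: free_module_carrier free_module_add free_module_smult free_gen_def)
      ultimately show ?thesis by simp
    qed
  qed
  then show ?thesis using c by (auto simp: free_module_carrier)
qed

end

context module
begin

text \<open>The sum in \<open>free_lift\<close> runs over the support, which changes under addition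
  and scaling. A common finite index set makes such sums comparable term by term.\<close>

lemma free_lift_eq:
  assumes "f \<in> B \<rightarrow> carrier M" "c \<in> carrier (free_module R B)"
    and "finite T" "T \<subseteq> B" "{x. c x \<noteq> \<zero>} \<subseteq> T"
  shows "free_lift R M f c = (\<Oplus>\<^bsub>M\<^esub>x\<in>T. c x \<odot>\<^bsub>M\<^esub> f x)"
  unfolding free_lift_def
  by (rule M.add.finprod_mono_neutral_cong_left)
    (use assms in \<open>auto simp: R.free_module_carrier Pi_iff subset_iff\<close>)

lemma free_lift_linear:
  assumes f: "f \<in> B \<rightarrow> carrier M"
  shows "linear_map R (free_module R B) M (free_lift R M f)"
proof -
  let ?F = "free_module R B"
  interpret F: module R ?F by (rule R.module_free_module)
  show ?thesis
  proof unfold_locales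
    fix c assume c: "c \<in> carrier ?F"
    then show "free_lift R M f c \<in> carrier M"
      unfolding free_lift_def using f
      by (intro M.finsum_closed) (auto simp: R.free_module_carrier)
    fix a assume a: "a \<in> carrier R"
    let ?T = "{x. c x \<noteq> \<zero>}"
    have T: "finite ?T" "?T \<subseteq> B" and cT: "\<And>x. c x \<in> carrier R"
      using c by (auto simp: R.free_module_carrier)
    have "free_lift R M f (a \<odot>\<^bsub>?F\<^esub> c) = (\<Oplus>\<^bsub>M\<^esub>x\<in>?T. (a \<odot>\<^bsub>?F\<^esub> c) x \<odot>\<^bsub>M\<^esub> f x)"
      by (rule free_lift_eq[OF f F.smult_closed[OF a c] T]) (use a cT in \<open>auto simp: R.free_module_smult\<close>)
    also have "\<dots> = (\<Oplus>\<^bsub>M\<^esub>x\<in>?T. a \<odot>\<^bsub>M\<^esub> (c x \<odot>\<^bsub>M\<^esub> f x))"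
      by (rule M.finsum_cong') (use a cT f T in \<open>auto simp: R.free_module_smult smult_assoc1 Pi_iff subset_iff\<close>)
    also have "\<dots> = a \<odot>\<^bsub>M\<^esub> free_lift R M f c"
      unfolding free_lift_def
      by (rule finsum_smult_ldistr[symmetric]) (use T a cT f in auto)
    finally show "free_lift R M f (a \<odot>\<^bsub>?F\<^esub> c) = a \<odot>\<^bsub>M\<^esub> free_lift R M f c" .
  next
    fix c d assume c: "c \<in> carrier ?F" and d: "d \<in> carrier ?F"
    let ?T = "{x. c x \<noteq> \<zero>} \<union> {x. d x \<noteq> \<zero>}"
    have T: "finite ?T" "?T \<subseteq> B" and cT: "\<And>x. c x \<in> carrier R" "\<And>x. d x \<in> carrier R"
      using c d by (auto simp: R.free_module_carrier)
    have "free_lift R M f (c \<oplus>\<^bsub>?F\<^esub> d) = (\<Oplus>\<^bsub>M\<^esub>x\<in>?T. (c \<oplus>\<^bsub>?F\<^esub> d) x \<odot>\<^bsub>M\<^esub> f x)"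
      by (rule free_lift_eq[OF f F.M.a_closed[OF c d] T]) (use cT in \<open>auto simp: R.free_module_add\<close>)
    also have "\<dots> = (\<Oplus>\<^bsub>M\<^esub>x\<in>?T. c x \<odot>\<^bsub>M\<^esub> f x \<oplus>\<^bsub>M\<^esub> d x \<odot>\<^bsub>M\<^esub> f x)"
      by (rule M.finsum_cong')
        (use cT f T in \<open>auto simp: R.free_module_add smult_l_distr Pi_iff subset_iff\<close>)
    also have "\<dots> = (\<Oplus>\<^bsub>M\<^esub>x\<in>?T. c x \<odot>\<^bsub>M\<^esub> f x) \<oplus>\<^bsub>M\<^esub> (\<Oplus>\<^bsub>M\<^esub>x\<in>?T. d x \<odot>\<^bsub>M\<^esub> f x)"
      by (rule M.finsum_addf) (use cT f T in \<open>auto simp: Pi_iff subset_iff\<close>)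
    also have "\<dots> = free_lift R M f c \<oplus>\<^bsub>M\<^esub> free_lift R M f d"
      using free_lift_eq[OF f c T] free_lift_eq[OF f d T] by simp
    finally show "free_lift R M f (c \<oplus>\<^bsub>?F\<^esub> d) = free_lift R M f c \<oplus>\<^bsub>M\<^esub> free_lift R M f d" .
  qed
qed

lemma free_lift_gen:
  assumes "f \<in> B \<rightarrow> carrier M" "x \<in> B"
  shows "free_lift R M f (free_gen R x) = f x"
proof -
  have "free_lift R M f (free_gen R x) = (\<Oplus>\<^bsub>M\<^esub>y\<in>{x}. free_gen R x y \<odot>\<^bsub>M\<^esub> f y)"
    by (rule free_lift_eq[OF assms(1) R.free_gen_closed])
      (use assms in \<open>auto simp: free_gen_def\<close>)
  also have "\<dots> = f x"
    using assms by (auto simp: free_gen_def Pi_iff)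
  finally show ?thesis .
qed

end


section \<open>Universal properties of tensor and exterior powers\<close>

text \<open>The split \<open>xs @ x # ys\<close> marks one slot without index arithmetic and has the
  shape of the generators in \<open>tensor_rels\<close>, so that each axiom matches one family of
  relations.\<close>

locale multilinear_map = M: module R M + P: module R P
  for R :: "('r, 'q) ring_scheme" (structure)
    and M :: "('r, 'm, 'e) module_scheme" and P :: "('r, 'p, 'd) module_scheme" +
  fixes n :: nat and f :: "'m list \<Rightarrow> 'p"
  assumes multi_closed: "xs \<in> tuples M n \<Longrightarrow> f xs \<in> carrier P"
    and multi_add: "\<lbrakk>xs @ x # ys \<in> tuples M n; y \<in> carrier M\<rbrakk>
      \<Longrightarrow> f (xs @ (x \<oplus>\<^bsub>M\<^esub> y) # ys) = f (xs @ x # ys) \<oplus>\<^bsub>P\<^esub> f (xs @ y # ys)"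
    and multi_smult: "\<lbrakk>xs @ x # ys \<in> tuples M n; a \<in> carrier R\<rbrakk>
      \<Longrightarrow> f (xs @ (a \<odot>\<^bsub>M\<^esub> x) # ys) = a \<odot>\<^bsub>P\<^esub> f (xs @ x # ys)"

text \<open>Only adjacent repetitions are mentioned, as in \<open>ext_rels\<close>; together with
  multilinearity they force the value to vanish on every repeated argument.\<close>

locale alternating_map = multilinear_map +
  assumes multi_alternating: "xs @ x # x # ys \<in> tuples M n \<Longrightarrow> f (xs @ x # x # ys) = \<zero>\<^bsub>P\<^esub>"

lemma multilinear_map_comp:
  assumes "multilinear_map R M P n f" "linear_map R P Q h"
  shows "multilinear_map R M Q n (\<lambda>xs. h (f xs))"
proof -
  interpret f: multilinear_map R M P n f by fact
  interpret h: linear_map R P Q h by fact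
  have "xs @ y # ys \<in> tuples M n" if "xs @ x # ys \<in> tuples M n" "y \<in> carrier M" for xs x y ys
    using that by (simp_all add: tuples_def)
  then show ?thesis
    by unfold_locales (auto simp: f.multi_closed h.hom_closed f.multi_add f.multi_smult
        h.hom_add h.hom_smult)
qed

lemma (in multilinear_map) multi_zero:
  assumes "xs @ \<zero>\<^bsub>M\<^esub> # ys \<in> tuples M n"
  shows "f (xs @ \<zero>\<^bsub>M\<^esub> # ys) = \<zero>\<^bsub>P\<^esub>"
  using multi_smult[OF assms M.R.zero_closed] multi_closed[OF assms] by simp

lemma multilinear_map_finsum:
  assumes "module R M" "module R P" "finite I" "\<And>i. i \<in> I \<Longrightarrow> multilinear_map R M P n (f i)"
  shows "multilinear_map R M P n (\<lambda>xs. \<Oplus>\<^bsub>P\<^esub>i\<in>I. f i xs)"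
proof -
  interpret M: module R M by fact
  interpret P: module R P by fact
  note cl = multilinear_map.multi_closed[OF assms(4)]
  show ?thesis
  proof unfold_locales
    fix xs assume "xs \<in> tuples M n"
    then show "(\<Oplus>\<^bsub>P\<^esub>i\<in>I. f i xs) \<in> carrier P" using cl by (auto intro!: P.M.finsum_closed)
  next
    fix xs x ys y assume a: "xs @ x # ys \<in> tuples M n" "y \<in> carrier M"
    have t: "xs @ y # ys \<in> tuples M n" using a by (simp add: tuples_def)
    have "(\<Oplus>\<^bsub>P\<^esub>i\<in>I. f i (xs @ (x \<oplus>\<^bsub>M\<^esub> y) # ys))
        = (\<Oplus>\<^bsub>P\<^esub>i\<in>I. f i (xs @ x # ys) \<oplus>\<^bsub>P\<^esub> f i (xs @ y # ys))"
      by (rule P.M.finsum_cong')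
        (use a t in \<open>auto simp: multilinear_map.multi_add[OF assms(4)] cl intro!: P.M.a_closed\<close>)
    also have "\<dots> = (\<Oplus>\<^bsub>P\<^esub>i\<in>I. f i (xs @ x # ys)) \<oplus>\<^bsub>P\<^esub> (\<Oplus>\<^bsub>P\<^esub>i\<in>I. f i (xs @ y # ys))"
      using a t by (intro P.M.finsum_addf) (simp_all add: Pi_iff cl)
    finally show "(\<Oplus>\<^bsub>P\<^esub>i\<in>I. f i (xs @ (x \<oplus>\<^bsub>M\<^esub> y) # ys))
      = (\<Oplus>\<^bsub>P\<^esub>i\<in>I. f i (xs @ x # ys)) \<oplus>\<^bsub>P\<^esub> (\<Oplus>\<^bsub>P\<^esub>i\<in>I. f i (xs @ y # ys))" .
  next
    fix xs x ys a assume a: "xs @ x # ys \<in> tuples M n" "a \<in> carrier R"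
    have "(\<Oplus>\<^bsub>P\<^esub>i\<in>I. f i (xs @ (a \<odot>\<^bsub>M\<^esub> x) # ys)) = (\<Oplus>\<^bsub>P\<^esub>i\<in>I. a \<odot>\<^bsub>P\<^esub> f i (xs @ x # ys))"
      by (rule P.M.finsum_cong')
        (use a in \<open>auto simp: multilinear_map.multi_smult[OF assms(4)] cl intro!: P.smult_closed\<close>)
    also have "\<dots> = a \<odot>\<^bsub>P\<^esub> (\<Oplus>\<^bsub>P\<^esub>i\<in>I. f i (xs @ x # ys))"
      using a by (intro P.finsum_smult_ldistr[symmetric] assms(3)) (simp_all add: Pi_iff cl)
    finally show "(\<Oplus>\<^bsub>P\<^esub>i\<in>I. f i (xs @ (a \<odot>\<^bsub>M\<^esub> x) # ys)) = a \<odot>\<^bsub>P\<^esub> (\<Oplus>\<^bsub>P\<^esub>i\<in>I. f i (xs @ x # ys))" .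
  qed
qed

locale bilinear_map = M: module R M + P: module R P
  for R :: "('r, 'q) ring_scheme" (structure)
    and M :: "('r, 'm, 'e) module_scheme" and P :: "('r, 'p, 'd) module_scheme" +
  fixes b :: "'m \<Rightarrow> 'm \<Rightarrow> 'p"
  assumes bi_closed: "\<lbrakk>x \<in> carrier M; y \<in> carrier M\<rbrakk> \<Longrightarrow> b x y \<in> carrier P"
    and bi_add_left: "\<lbrakk>x \<in> carrier M; y \<in> carrier M; z \<in> carrier M\<rbrakk>
      \<Longrightarrow> b (x \<oplus>\<^bsub>M\<^esub> y) z = b x z \<oplus>\<^bsub>P\<^esub> b y z"
    and bi_add_right: "\<lbrakk>x \<in> carrier M; y \<in> carrier M; z \<in> carrier M\<rbrakk>
      \<Longrightarrow> b x (y \<oplus>\<^bsub>M\<^esub> z) = b x y \<oplus>\<^bsub>P\<^esub> b x z"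
    and bi_smult_left: "\<lbrakk>a \<in> carrier R; x \<in> carrier M; y \<in> carrier M\<rbrakk>
      \<Longrightarrow> b (a \<odot>\<^bsub>M\<^esub> x) y = a \<odot>\<^bsub>P\<^esub> b x y"
    and bi_smult_right: "\<lbrakk>a \<in> carrier R; x \<in> carrier M; y \<in> carrier M\<rbrakk>
      \<Longrightarrow> b x (a \<odot>\<^bsub>M\<^esub> y) = a \<odot>\<^bsub>P\<^esub> b x y"
begin

lemma linear_left: "y \<in> carrier M \<Longrightarrow> linear_map R M P (\<lambda>x. b x y)"
  by unfold_locales (simp_all add: bi_closed bi_add_left bi_smult_left)

lemma linear_right: "x \<in> carrier M \<Longrightarrow> linear_map R M P (b x)"
  by unfold_locales (simp_all add: bi_closed bi_add_right bi_smult_right)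

lemmas bi_zero_left = linear_map.hom_zero[OF linear_left]
lemmas bi_zero_right = linear_map.hom_zero[OF linear_right]
lemmas bi_neg_right = linear_map.hom_neg[OF linear_right]

lemma multilinear: "multilinear_map R M P 2 (\<lambda>xs. b (xs ! 0) (xs ! 1))"
proof unfold_locales
  fix xs ys x y assume "xs @ x # ys \<in> tuples M 2" "y \<in> carrier M"
  then show "b ((xs @ (x \<oplus>\<^bsub>M\<^esub> y) # ys) ! 0) ((xs @ (x \<oplus>\<^bsub>M\<^esub> y) # ys) ! 1)
      = b ((xs @ x # ys) ! 0) ((xs @ x # ys) ! 1) \<oplus>\<^bsub>P\<^esub> b ((xs @ y # ys) ! 0) ((xs @ y # ys) ! 1)"
    by (cases xs) (auto simp: tuples_def bi_add_left bi_add_right nth_append length_Suc_conv)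
next
  fix xs ys x a assume "xs @ x # ys \<in> tuples M 2" "a \<in> carrier R"
  then show "b ((xs @ (a \<odot>\<^bsub>M\<^esub> x) # ys) ! 0) ((xs @ (a \<odot>\<^bsub>M\<^esub> x) # ys) ! 1)
      = a \<odot>\<^bsub>P\<^esub> b ((xs @ x # ys) ! 0) ((xs @ x # ys) ! 1)"
    by (cases xs) (auto simp: tuples_def bi_smult_left bi_smult_right nth_append length_Suc_conv)
qed (auto simp: tuples_def subset_iff intro!: bi_closed nth_mem)

end

lemma bilinear_map_comp:
  assumes "bilinear_map R M P b" "linear_map R P Q h"
  shows "bilinear_map R M Q (\<lambda>x y. h (b x y))"
proof -
  interpret b: bilinear_map R M P b by fact
  interpret h: linear_map R P Q h by fact
  show ?thesis
    by unfold_locales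
      (simp_all add: b.bi_closed h.hom_closed b.bi_add_left b.bi_add_right b.bi_smult_left
        b.bi_smult_right h.hom_add h.hom_smult)
qed

lemma bilinear_map_of_multilinear:
  assumes "multilinear_map R M P 2 f"
  shows "bilinear_map R M P (\<lambda>x y. f [x, y])"
proof -
  interpret f: multilinear_map R M P 2 f by fact
  show ?thesis
  proof unfold_locales
    fix x y assume "x \<in> carrier M" "y \<in> carrier M"
    then show "f [x, y] \<in> carrier P" by (intro f.multi_closed) (simp add: tuples_def)
  next
    fix x y z assume "x \<in> carrier M" "y \<in> carrier M" "z \<in> carrier M"
    then show "f [x \<oplus>\<^bsub>M\<^esub> y, z] = f [x, z] \<oplus>\<^bsub>P\<^esub> f [y, z]" "f [x, y \<oplus>\<^bsub>M\<^esub> z] = f [x, y] \<oplus>\<^bsub>P\<^esub> f [x, z]"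
      using f.multi_add[of "[]" x "[z]" y] f.multi_add[of "[x]" y "[]" z] by (simp_all add: tuples_def)
  next
    fix a x y assume "a \<in> carrier R" "x \<in> carrier M" "y \<in> carrier M"
    then show "f [a \<odot>\<^bsub>M\<^esub> x, y] = a \<odot>\<^bsub>P\<^esub> f [x, y]" "f [x, a \<odot>\<^bsub>M\<^esub> y] = a \<odot>\<^bsub>P\<^esub> f [x, y]"
      using f.multi_smult[of "[]" x "[y]" a] f.multi_smult[of "[x]" y "[]" a] by (simp_all add: tuples_def)
  qed
qed

lemma tuples_3_cases:
  assumes "xs @ x # ys \<in> tuples M 3"
  obtains u v where "xs = []" "ys = [u, v]" | u v where "xs = [u]" "ys = [v]" | u v where "xs = [u, v]" "ys = []"
  using assms by (cases xs; cases ys) (auto simp: tuples_def length_Suc_conv)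

text \<open>Serves the Killing relations and the Koszul map, where the map in each single slot is
  built from linear maps already known.\<close>

lemma multilinear_map_3I:
  assumes "module R M"
    and left: "\<And>y z. \<lbrakk>y \<in> carrier M; z \<in> carrier M\<rbrakk> \<Longrightarrow> linear_map R M P (\<lambda>x. t x y z)"
    and mid: "\<And>x z. \<lbrakk>x \<in> carrier M; z \<in> carrier M\<rbrakk> \<Longrightarrow> linear_map R M P (\<lambda>y. t x y z)"
    and right: "\<And>x y. \<lbrakk>x \<in> carrier M; y \<in> carrier M\<rbrakk> \<Longrightarrow> linear_map R M P (t x y)"
  shows "multilinear_map R M P 3 (\<lambda>xs. t (xs ! 0) (xs ! 1) (xs ! 2))"
proof -
  interpret M: module R M by fact
  interpret P: module R P
    using left[OF M.M.zero_closed M.M.zero_closed] by (simp add: linear_map_def)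
  show ?thesis
  proof unfold_locales
    fix xs assume "xs \<in> tuples M 3"
    then show "t (xs ! 0) (xs ! 1) (xs ! 2) \<in> carrier P"
      by (intro linear_map.hom_closed[OF right]) (auto simp: tuples_def)
  next
    fix xs ys x y assume a: "xs @ x # ys \<in> tuples M 3" "y \<in> carrier M"
    show "t ((xs @ (x \<oplus>\<^bsub>M\<^esub> y) # ys) ! 0) ((xs @ (x \<oplus>\<^bsub>M\<^esub> y) # ys) ! 1) ((xs @ (x \<oplus>\<^bsub>M\<^esub> y) # ys) ! 2)
      = t ((xs @ x # ys) ! 0) ((xs @ x # ys) ! 1) ((xs @ x # ys) ! 2)
        \<oplus>\<^bsub>P\<^esub> t ((xs @ y # ys) ! 0) ((xs @ y # ys) ! 1) ((xs @ y # ys) ! 2)"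
      by (rule tuples_3_cases[OF a(1)]; use a in \<open>simp add: tuples_def linear_map.hom_add[OF left]
          linear_map.hom_add[OF mid] linear_map.hom_add[OF right]\<close>)
  next
    fix xs ys x a assume a: "xs @ x # ys \<in> tuples M 3" "a \<in> carrier R"
    show "t ((xs @ (a \<odot>\<^bsub>M\<^esub> x) # ys) ! 0) ((xs @ (a \<odot>\<^bsub>M\<^esub> x) # ys) ! 1) ((xs @ (a \<odot>\<^bsub>M\<^esub> x) # ys) ! 2)
      = a \<odot>\<^bsub>P\<^esub> t ((xs @ x # ys) ! 0) ((xs @ x # ys) ! 1) ((xs @ x # ys) ! 2)"
      by (rule tuples_3_cases[OF a(1)]; use a in \<open>simp add: tuples_def linear_map.hom_smult[OF left]
          linear_map.hom_smult[OF mid] linear_map.hom_smult[OF right]\<close>)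
  qed
qed

section \<open>Tensor powers and their universal property\<close>

context module
begin

lemma tensor_rels_cases:
  assumes "c \<in> tensor_rels R M n"
  obtains (add) xs x y ys where "xs @ x # ys \<in> tuples M n" "x \<in> carrier M" "y \<in> carrier M"
      "xs @ y # ys \<in> tuples M n" "xs @ (x \<oplus>\<^bsub>M\<^esub> y) # ys \<in> tuples M n"
      "c = free_gen R (xs @ (x \<oplus>\<^bsub>M\<^esub> y) # ys) \<ominus>\<^bsub>free_module R (tuples M n)\<^esub>
         (free_gen R (xs @ x # ys) \<oplus>\<^bsub>free_module R (tuples M n)\<^esub> free_gen R (xs @ y # ys))"
    | (smult) xs x a ys where "xs @ x # ys \<in> tuples M n" "a \<in> carrier R"
      "xs @ (a \<odot>\<^bsub>M\<^esub> x) # ys \<in> tuples M n"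
      "c = free_gen R (xs @ (a \<odot>\<^bsub>M\<^esub> x) # ys) \<ominus>\<^bsub>free_module R (tuples M n)\<^esub>
         a \<odot>\<^bsub>free_module R (tuples M n)\<^esub> free_gen R (xs @ x # ys)"
proof -
  have tup: "xs @ y # ys \<in> tuples M n"
    if "xs @ x # ys \<in> tuples M n" "y \<in> carrier M" for xs x y ys
    using that by (simp_all add: tuples_def)
  from assms show thesis
    unfolding tensor_rels_def Let_def
  proof (elim UnE CollectE exE conjE)
    fix xs x y ys
    assume a: "c = free_gen R (xs @ [x \<oplus>\<^bsub>M\<^esub> y] @ ys) \<ominus>\<^bsub>free_module R (tuples M n)\<^esub>
         (free_gen R (xs @ [x] @ ys) \<oplus>\<^bsub>free_module R (tuples M n)\<^esub> free_gen R (xs @ [y] @ ys))"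
      "xs @ [x] @ ys \<in> tuples M n" "y \<in> carrier M"
    then have x: "x \<in> carrier M" by (simp add: tuples_def)
    show thesis
      by (rule add[of xs x ys y])
        (use a x tup[of xs x ys y] tup[of xs x ys "x \<oplus>\<^bsub>M\<^esub> y"] in simp_all)
  next
    fix xs a x ys
    assume a: "c = free_gen R (xs @ [a \<odot>\<^bsub>M\<^esub> x] @ ys) \<ominus>\<^bsub>free_module R (tuples M n)\<^esub>
         a \<odot>\<^bsub>free_module R (tuples M n)\<^esub> free_gen R (xs @ [x] @ ys)"
      "xs @ [x] @ ys \<in> tuples M n" "a \<in> carrier R"
    then have x: "x \<in> carrier M" by (simp add: tuples_def)
    show thesis
      by (rule smult[of xs x ys a]) (use a x tup[of xs x ys "a \<odot>\<^bsub>M\<^esub> x"] in simp_all)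
  qed
qed

lemma tensor_rels_subset: "tensor_rels R M n \<subseteq> carrier (free_module R (tuples M n))"
proof
  let ?F = "free_module R (tuples M n)"
  interpret F: module R ?F by (rule R.module_free_module)
  fix c assume "c \<in> tensor_rels R M n"
  then show "c \<in> carrier ?F"
    by (cases rule: tensor_rels_cases) (simp_all add: R.free_gen_closed)
qed

lemma tensor_quotient_module:
  "quotient_module R (free_module R (tuples M n))
    (submod_span R (free_module R (tuples M n)) (tensor_rels R M n))"
  by (intro module.quotient_module_span R.module_free_module tensor_rels_subset)

lemma module_tensor_power: "module R (tensor_power R M n)"
  unfolding tensor_power_def Let_def
  by (rule quotient_module.module_quot[OF tensor_quotient_module])

lemma tensor_eq:
  "xs \<in> tuples M n \<Longrightarrow> tensor R M xs =
    submod_span R (free_module R (tuples M n)) (tensor_rels R M n) +>\<^bsub>free_module R (tuples M n)\<^esub> free_gen R xs"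
  by (auto simp: tensor_def tuples_def Let_def)

text \<open>For each axiom, the difference of the two sides, written with free generators, is
  literally a member of \<open>tensor_rels\<close>; hence both sides have the same coset.\<close>

lemma tensor_multilinear: "multilinear_map R M (tensor_power R M n) n (tensor R M)"
proof -
  let ?F = "free_module R (tuples M n)" and ?T = "tensor_power R M n"
  let ?N = "submod_span R ?F (tensor_rels R M n)"
  let ?p = "\<lambda>c. ?N +>\<^bsub>?F\<^esub> c"
  interpret q: quotient_module R ?F ?N by (rule tensor_quotient_module)
  have T: "?T = q.Q" by (simp add: tensor_power_def Let_def)
  interpret T: module R ?T by (rule module_tensor_power)
  interpret p: linear_map R ?F ?T ?p unfolding T by (rule q.proj_linear)
  have rel: "?p c = ?p d" if "c \<ominus>\<^bsub>?F\<^esub> d \<in> tensor_rels R M n" "c \<in> carrier ?F" "d \<in> carrier ?F" for c d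
    using that q.coset_eq_iff q.submod_span_superset by auto
  show ?thesis
  proof unfold_locales
    fix xs assume "xs \<in> tuples M n"
    then show "tensor R M xs \<in> carrier ?T"
      by (simp add: tensor_eq p.hom_closed R.free_gen_closed)
  next
    fix xs x ys y assume a: "xs @ x # ys \<in> tuples M n" "y \<in> carrier M"
    then have t: "xs @ y # ys \<in> tuples M n" "xs @ (x \<oplus>\<^bsub>M\<^esub> y) # ys \<in> tuples M n"
      by (simp_all add: tuples_def)
    have "free_gen R (xs @ (x \<oplus>\<^bsub>M\<^esub> y) # ys)
         \<ominus>\<^bsub>?F\<^esub> (free_gen R (xs @ x # ys) \<oplus>\<^bsub>?F\<^esub> free_gen R (xs @ y # ys)) \<in> tensor_rels R M n"
      unfolding tensor_rels_def Let_def using a by auto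
    from rel[OF this]
    show "tensor R M (xs @ (x \<oplus>\<^bsub>M\<^esub> y) # ys)
        = tensor R M (xs @ x # ys) \<oplus>\<^bsub>?T\<^esub> tensor R M (xs @ y # ys)"
      using a(1) t by (simp add: tensor_eq p.hom_add R.free_gen_closed)
  next
    fix xs x ys a assume a: "xs @ x # ys \<in> tuples M n" "a \<in> carrier R"
    then have t: "xs @ (a \<odot>\<^bsub>M\<^esub> x) # ys \<in> tuples M n"
      by (simp_all add: tuples_def)
    have "free_gen R (xs @ (a \<odot>\<^bsub>M\<^esub> x) # ys) \<ominus>\<^bsub>?F\<^esub> a \<odot>\<^bsub>?F\<^esub> free_gen R (xs @ x # ys) \<in> tensor_rels R M n"
      unfolding tensor_rels_def Let_def using a by auto
    from rel[OF this]
    show "tensor R M (xs @ (a \<odot>\<^bsub>M\<^esub> x) # ys) = a \<odot>\<^bsub>?T\<^esub> tensor R M (xs @ x # ys)"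
      using a t by (simp add: tensor_eq p.hom_smult R.free_gen_closed)
  qed
qed

lemma tensor_closed: "xs \<in> tuples M n \<Longrightarrow> tensor R M xs \<in> carrier (tensor_power R M n)"
  by (rule multilinear_map.multi_closed[OF tensor_multilinear])

text \<open>Existence in the universal property: multilinearity of \<open>f\<close> says precisely
  that the linear extension of \<open>f\<close> kills the generating relations, hence their span, so
  it descends to the quotient.\<close>

lemma
  assumes "multilinear_map R M P n f"
  shows tensor_lift_linear: "linear_map R (tensor_power R M n) P (tensor_lift R P f)"
    and tensor_lift_tensor: "xs \<in> tuples M n \<Longrightarrow> tensor_lift R P f (tensor R M xs) = f xs"
proof -
  let ?F = "free_module R (tuples M n)"
  interpret q: quotient_module R ?F "submod_span R ?F (tensor_rels R M n)"
    by (rule tensor_quotient_module)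
  interpret f: multilinear_map R M P n f by fact
  have f: "f \<in> tuples M n \<rightarrow> carrier P" using f.multi_closed by auto
  interpret h: linear_map R ?F P "free_lift R P f" by (rule f.P.free_lift_linear[OF f])
  note gen = f.P.free_lift_gen[OF f]
  have "free_lift R P f c = \<zero>\<^bsub>P\<^esub>" if "c \<in> tensor_rels R M n" for c
  proof -
    from that show ?thesis
      by (cases rule: tensor_rels_cases)
        (simp_all add: h.hom_minus h.hom_add h.hom_smult gen R.free_gen_closed f.multi_add
          f.multi_smult f.multi_closed f.P.M.minus_eq f.P.M.r_neg)
  qed
  note zero = linear_map_zero_on_span[OF h.linear_map_axioms tensor_rels_subset this]
  show "linear_map R (tensor_power R M n) P (tensor_lift R P f)"
    unfolding tensor_power_def tensor_lift_def Let_def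
    by (rule q.quot_lift_linear[OF h.linear_map_axioms zero])
  show "tensor_lift R P f (tensor R M xs) = f xs" if "xs \<in> tuples M n"
    unfolding tensor_eq[OF that] tensor_lift_def
    by (simp add: q.quot_lift_proj[OF h.linear_map_axioms zero] R.free_gen_closed that gen)
qed

lemma tensor_power_eqI:
  assumes "linear_map R (tensor_power R M n) P h" "linear_map R (tensor_power R M n) P k"
    and eq: "\<And>xs. xs \<in> tuples M n \<Longrightarrow> h (tensor R M xs) = k (tensor R M xs)"
    and X: "X \<in> carrier (tensor_power R M n)"
  shows "h X = k X"
proof -
  let ?F = "free_module R (tuples M n)"
  let ?p = "\<lambda>c. submod_span R ?F (tensor_rels R M n) +>\<^bsub>?F\<^esub> c"
  interpret q: quotient_module R ?F "submod_span R ?F (tensor_rels R M n)"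
    by (rule tensor_quotient_module)
  have T: "tensor_power R M n = q.Q" by (simp add: tensor_power_def Let_def)
  note lin = linear_map_comp[OF q.proj_linear assms(1)[unfolded T]]
    linear_map_comp[OF q.proj_linear assms(2)[unfolded T]]
  show ?thesis
  proof (rule q.linear_map_quot_eqI[OF assms(1,2)[unfolded T] _ X[unfolded T]])
    fix c assume "c \<in> carrier ?F"
    \<comment> \<open>The equalizer of the two composites with the projection contains every free
      generator, since these project to the tensors.\<close>
    then have "c \<in> {c \<in> carrier ?F. h (?p c) = k (?p c)}"
      by (rule R.free_module_induct[OF equalizer_submodule[OF lin], rotated])
        (use eq in \<open>auto simp: R.free_gen_closed tensor_eq\<close>)
    then show "h (?p c) = k (?p c)" by simp
  qed
qed

section \<open>Exterior powers and their universal property\<close>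

lemma ext_rels_subset: "ext_rels R M n \<subseteq> carrier (tensor_power R M n)"
  by (auto simp: ext_rels_def intro!: tensor_closed)

lemma ext_quotient_module:
  "quotient_module R (tensor_power R M n) (submod_span R (tensor_power R M n) (ext_rels R M n))"
  by (intro module.quotient_module_span module_tensor_power ext_rels_subset)

lemma module_ext_power: "module R (ext_power R M n)"
  unfolding ext_power_def by (rule quotient_module.module_quot[OF ext_quotient_module])

lemma wedge_eq:
  "xs \<in> tuples M n \<Longrightarrow> wedge R M xs =
    submod_span R (tensor_power R M n) (ext_rels R M n) +>\<^bsub>tensor_power R M n\<^esub> tensor R M xs"
  by (auto simp: wedge_def tuples_def Let_def)

lemma wedge_alternating: "alternating_map R M (ext_power R M n) n (wedge R M)"
proof -
  let ?T = "tensor_power R M n"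
  let ?N = "submod_span R ?T (ext_rels R M n)"
  interpret q: quotient_module R ?T ?N by (rule ext_quotient_module)
  have E: "ext_power R M n = q.Q" by (simp add: ext_power_def)
  interpret c: multilinear_map R M "ext_power R M n" n "\<lambda>xs. ?N +>\<^bsub>?T\<^esub> tensor R M xs"
    unfolding E by (rule multilinear_map_comp[OF tensor_multilinear q.proj_linear])
  have t: "xs @ y # ys \<in> tuples M n" if "xs @ x # ys \<in> tuples M n" "y \<in> carrier M" for xs x y ys
    using that by (simp_all add: tuples_def)
  have t': "x \<in> carrier M" if "xs @ x # ys \<in> tuples M n" for xs x ys
    using that by (simp_all add: tuples_def)
  show ?thesis
  proof unfold_locales
    fix xs x ys assume a: "xs @ x # x # ys \<in> tuples M n"
    then have "tensor R M (xs @ x # x # ys) \<in> ext_rels R M n"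
      by (auto simp: ext_rels_def)
    then have "tensor R M (xs @ x # x # ys) \<in> ?N"
      using q.submod_span_superset by auto
    then show "wedge R M (xs @ x # x # ys) = \<zero>\<^bsub>ext_power R M n\<^esub>"
      by (simp add: wedge_eq[OF a] E q.proj_eq_zero)
  next
    fix xs x ys y assume a: "xs @ x # ys \<in> tuples M n" "y \<in> carrier M"
    show "wedge R M (xs @ (x \<oplus>\<^bsub>M\<^esub> y) # ys)
        = wedge R M (xs @ x # ys) \<oplus>\<^bsub>ext_power R M n\<^esub> wedge R M (xs @ y # ys)"
      using a t[OF a] t[OF a(1) M.a_closed[OF t'[OF a(1)] a(2)]] by (simp add: wedge_eq c.multi_add)
  next
    fix xs x ys b assume a: "xs @ x # ys \<in> tuples M n" "b \<in> carrier R"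
    show "wedge R M (xs @ (b \<odot>\<^bsub>M\<^esub> x) # ys) = b \<odot>\<^bsub>ext_power R M n\<^esub> wedge R M (xs @ x # ys)"
      using a t[OF a(1) smult_closed[OF a(2) t'[OF a(1)]]] by (simp add: wedge_eq c.multi_smult)
  qed (simp add: wedge_eq c.multi_closed)
qed

lemma wedge_closed:
  "xs \<in> tuples M n \<Longrightarrow> wedge R M xs \<in> carrier (ext_power R M n)"
  by (rule multilinear_map.multi_closed[OF alternating_map.axioms(1)[OF wedge_alternating]])

text \<open>A second descent on top of \<open>tensor_lift\<close>: the new relations are tensors
  with two equal neighbours, on which an alternating \<open>f\<close> is zero.\<close>

lemma
  assumes "alternating_map R M P n f"
  shows ext_lift_linear: "linear_map R (ext_power R M n) P (ext_lift R P f)"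
    and ext_lift_wedge: "xs \<in> tuples M n \<Longrightarrow> ext_lift R P f (wedge R M xs) = f xs"
proof -
  let ?T = "tensor_power R M n"
  interpret q: quotient_module R ?T "submod_span R ?T (ext_rels R M n)"
    by (rule ext_quotient_module)
  interpret f: alternating_map R M P n f by fact
  note lin = tensor_lift_linear[OF f.multilinear_map_axioms]
  note lift = tensor_lift_tensor[OF f.multilinear_map_axioms]
  have "tensor_lift R P f c = \<zero>\<^bsub>P\<^esub>" if "c \<in> ext_rels R M n" for c
    using that by (auto simp: ext_rels_def lift f.multi_alternating)
  note zero = linear_map_zero_on_span[OF lin ext_rels_subset this]
  show "linear_map R (ext_power R M n) P (ext_lift R P f)"
    unfolding ext_power_def ext_lift_def by (rule q.quot_lift_linear[OF lin zero])
  show "ext_lift R P f (wedge R M xs) = f xs" if "xs \<in> tuples M n"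
    unfolding wedge_eq[OF that] ext_lift_def
    by (simp add: q.quot_lift_proj[OF lin zero] tensor_closed that lift)
qed

lemma ext_power_eqI:
  assumes "linear_map R (ext_power R M n) P h" "linear_map R (ext_power R M n) P k"
    and eq: "\<And>xs. xs \<in> tuples M n \<Longrightarrow> h (wedge R M xs) = k (wedge R M xs)"
    and X: "X \<in> carrier (ext_power R M n)"
  shows "h X = k X"
proof -
  let ?T = "tensor_power R M n"
  interpret q: quotient_module R ?T "submod_span R ?T (ext_rels R M n)"
    by (rule ext_quotient_module)
  note h = assms(1)[unfolded ext_power_def] and k = assms(2)[unfolded ext_power_def]
  show ?thesis
  proof (rule q.linear_map_quot_eqI[OF h k _ X[unfolded ext_power_def]])
    fix c assume c: "c \<in> carrier ?T"
    show "h (submod_span R ?T (ext_rels R M n) +>\<^bsub>?T\<^esub> c) = k (submod_span R ?T (ext_rels R M n) +>\<^bsub>?T\<^esub> c)"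
      by (rule tensor_power_eqI[OF linear_map_comp[OF q.proj_linear h] linear_map_comp[OF q.proj_linear k] _ c])
        (use eq in \<open>simp add: wedge_eq\<close>)
  qed
qed

section \<open>The symmetric square\<close>

lemma sym_rels_subset: "sym_rels R M \<subseteq> carrier (tensor_power R M 2)"
proof -
  interpret T: module R "tensor_power R M 2" by (rule module_tensor_power)
  show ?thesis
    by (auto simp: sym_rels_def tuples_def intro!: T.M.minus_closed tensor_closed)
qed

lemma sym_quotient_module:
  "quotient_module R (tensor_power R M 2) (submod_span R (tensor_power R M 2) (sym_rels R M))"
  by (intro module.quotient_module_span module_tensor_power sym_rels_subset)

lemma sym_prod_bilinear: "bilinear_map R M (sym_square R M) (sym_prod R M)"
proof -
  interpret q: quotient_module R "tensor_power R M 2" "submod_span R (tensor_power R M 2) (sym_rels R M)"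
    by (rule sym_quotient_module)
  show ?thesis
    using bilinear_map_of_multilinear[OF multilinear_map_comp[OF tensor_multilinear q.proj_linear]]
    by (simp add: sym_prod_def[abs_def] sym_square_def)
qed

lemma sym_prod_commute:
  assumes "x \<in> carrier M" "y \<in> carrier M"
  shows "sym_prod R M x y = sym_prod R M y x"
proof -
  let ?T = "tensor_power R M 2"
  interpret q: quotient_module R ?T "submod_span R ?T (sym_rels R M)"
    by (rule sym_quotient_module)
  have "tensor R M [x, y] \<ominus>\<^bsub>?T\<^esub> tensor R M [y, x] \<in> sym_rels R M"
    using assms by (auto simp: sym_rels_def)
  moreover have "tensor R M [x, y] \<in> carrier ?T" "tensor R M [y, x] \<in> carrier ?T"
    using assms by (auto intro!: tensor_closed simp: tuples_def)
  ultimately show ?thesis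
    using q.submod_span_superset by (auto simp: sym_prod_def q.coset_eq_iff)
qed

end


section \<open>The boundary map in degrees three and four\<close>

lemma (in cring) minus_one_power: "(\<ominus> \<one>) [^] (k::nat) = (if even k then \<one> else \<ominus> \<one>)"
  by (induction k) (simp_all add: l_minus)

text \<open>\<open>nths\<close> selects by position, so whether the entry between \<open>xs\<close>
  and \<open>ys\<close> survives does not depend on its value. This exposes how a boundary term
  depends on one chosen argument.\<close>

lemma nths_insertion:
  "nths (xs @ x # ys) S = nths xs S @ (if length xs \<in> S then [x] else []) @ nths ys {k. Suc k + length xs \<in> S}"
  by (simp add: nths_append nths_Cons)

context lie_algebra
begin

lemma br_bilinear: "bilinear_map R L L br"
  by unfold_locales
    (simp_all add: br_closed br_add_left br_add_right br_smult_left br_smult_right)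

sublocale br: bilinear_map R L L br by (rule br_bilinear)

lemma br_skew:
  assumes "x \<in> carrier L" "y \<in> carrier L"
  shows "br x y = \<ominus>\<^bsub>L\<^esub> br y x"
proof -
  have "br (x \<oplus>\<^bsub>L\<^esub> y) (x \<oplus>\<^bsub>L\<^esub> y) = \<zero>\<^bsub>L\<^esub>"
    using assms by (intro br_alternating) simp
  then have "(br x x \<oplus>\<^bsub>L\<^esub> br x y) \<oplus>\<^bsub>L\<^esub> (br y x \<oplus>\<^bsub>L\<^esub> br y y) = \<zero>\<^bsub>L\<^esub>"
    using assms by (simp add: br_add_left br_add_right br_closed M.a_ac)
  then have "br x y \<oplus>\<^bsub>L\<^esub> br y x = \<zero>\<^bsub>L\<^esub>"
    using assms by (simp add: br_alternating br_closed)
  then show ?thesis using assms by (metis M.minus_equality br_closed)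
qed

section \<open>The boundary on tuples of vectors\<close>

definition bracket_term :: "'g list \<Rightarrow> nat \<Rightarrow> nat \<Rightarrow> 'g list" where
  "bracket_term xs i j = br (xs ! i) (xs ! j) # nths xs (- {i, j})"

lemma bracket_term_tuples:
  assumes "xs \<in> tuples L n" "i < j" "j < n"
  shows "bracket_term xs i j \<in> tuples L (n - 1)"
proof -
  have "{k. k < n \<and> k \<in> - {i, j}} = {..<n} - {i, j}" by auto
  moreover have "card ({..<n} - {i, j}) = n - 2"
    using assms by (subst card_Diff_subset) auto
  ultimately have "length (nths xs (- {i, j})) = n - 2"
    using assms by (simp add: length_nths tuples_def)
  moreover have "set (nths xs (- {i, j})) \<subseteq> carrier L"
    using assms set_nths_subset[of xs "- {i, j}"] by (auto simp: tuples_def)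
  moreover have "xs ! i \<in> carrier L" "xs ! j \<in> carrier L"
    using assms by (auto simp: tuples_def)
  ultimately show ?thesis
    using assms by (simp add: bracket_term_def tuples_def br_closed)
qed

text \<open>As a function of one argument \<open>z\<close>, a boundary term always has the form
  \<open>us @ g z # ws\<close> with \<open>g\<close> linear: either \<open>z\<close> sits inside the
  bracket and \<open>g\<close> is bracketing with the other entry, or \<open>z\<close> survives the
  deletion and \<open>g\<close> is the identity. Multilinearity of \<open>f\<close> then gives that
  of the composite.\<close>

lemma bracket_term_multilinear:
  assumes f: "multilinear_map R L P (n - 1) f" and ij: "i < j" "j < n"
  shows "multilinear_map R L P n (\<lambda>xs. f (bracket_term xs i j))"
proof -
  interpret f: multilinear_map R L P "n - 1" f by fact
  have key: "\<exists>us ws g. linear_map R L L g \<and> (\<forall>z\<in>carrier L. bracket_term (xs @ z # ys) i j = us @ g z # ws)"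
    if t: "xs @ x # ys \<in> tuples L n" for xs x ys
  proof -
    let ?p = "length xs"
    have n: "n = Suc (?p + length ys)" "set xs \<subseteq> carrier L" "set ys \<subseteq> carrier L"
      using t by (auto simp: tuples_def)
    \<comment> \<open>Away from position \<open>?p\<close> nothing depends on \<open>z\<close>, so
      zero serves as a placeholder there; this makes the other bracket entry and the remaining list
      independent of \<open>z\<close>.\<close>
    have nth: "(xs @ z # ys) ! k = (xs @ \<zero>\<^bsub>L\<^esub> # ys) ! k" "(xs @ z # ys) ! k \<in> carrier L" if "k < n" "k \<noteq> ?p" for k z
    proof -
      show "(xs @ z # ys) ! k = (xs @ \<zero>\<^bsub>L\<^esub> # ys) ! k"
        using that by (simp add: nth_append nth_Cons')
      show "(xs @ z # ys) ! k \<in> carrier L"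
        using that n by (auto simp: nth_append nth_Cons' subset_iff)
    qed
    have nths: "nths (xs @ z # ys) (- {i, j}) = nths (xs @ \<zero>\<^bsub>L\<^esub> # ys) (- {i, j})"
      if "?p = i \<or> ?p = j" for z
      using that by (auto simp: nths_insertion)
    consider "?p = i" | "?p = j" | "?p \<noteq> i" "?p \<noteq> j" by blast
    then show ?thesis
    proof cases
      case 1
      with ij have j: "j < n" "j \<noteq> ?p" by auto
      let ?b = "(xs @ \<zero>\<^bsub>L\<^esub> # ys) ! j"
      have "bracket_term (xs @ z # ys) i j = [] @ br z ?b # nths (xs @ \<zero>\<^bsub>L\<^esub> # ys) (- {i, j})" for z
        using nth(1)[OF j, of z] nths[of z] by (simp add: bracket_term_def 1[symmetric])
      with br.linear_left[OF nth(2)[OF j]] show ?thesis by blast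
    next
      case 2
      with ij have i: "i < n" "i \<noteq> ?p" by auto
      let ?b = "(xs @ \<zero>\<^bsub>L\<^esub> # ys) ! i"
      have "bracket_term (xs @ z # ys) i j = [] @ br ?b z # nths (xs @ \<zero>\<^bsub>L\<^esub> # ys) (- {i, j})" for z
        using nth(1)[OF i, of z] nths[of z] by (simp add: bracket_term_def 2[symmetric])
      with br.linear_right[OF nth(2)[OF i]] show ?thesis by blast
    next
      case 3
      with ij have i: "i < n" "i \<noteq> ?p" and j: "j < n" "j \<noteq> ?p" by auto
      let ?a = "(xs @ \<zero>\<^bsub>L\<^esub> # ys) ! i" and ?b = "(xs @ \<zero>\<^bsub>L\<^esub> # ys) ! j"
      have "bracket_term (xs @ z # ys) i j
          = (br ?a ?b # nths xs (- {i, j})) @ z # nths ys {k. Suc k + ?p \<in> - {i, j}}" for z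
        unfolding bracket_term_def nth(1)[OF i, of z] nth(1)[OF j, of z] nths_insertion
        using 3 by simp
      moreover have "linear_map R L L (\<lambda>z. z)"
        by unfold_locales simp_all
      ultimately show ?thesis by blast
    qed
  qed
  show ?thesis
  proof unfold_locales
    fix xs assume "xs \<in> tuples L n"
    then show "f (bracket_term xs i j) \<in> carrier P"
      using ij by (intro f.multi_closed bracket_term_tuples)
  next
    fix xs x ys y assume a: "xs @ x # ys \<in> tuples L n" "y \<in> carrier L"
    then have x: "x \<in> carrier L" by (simp add: tuples_def)
    from key[OF a(1)] obtain us ws g where g: "linear_map R L L g"
      and eq: "\<And>z. z \<in> carrier L \<Longrightarrow> bracket_term (xs @ z # ys) i j = us @ g z # ws" by blast
    interpret g: linear_map R L L g by fact
    have "us @ g x # ws \<in> tuples L (n - 1)"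
      using bracket_term_tuples[OF a(1) ij] eq[OF x] by simp
    then show "f (bracket_term (xs @ (x \<oplus>\<^bsub>L\<^esub> y) # ys) i j)
        = f (bracket_term (xs @ x # ys) i j) \<oplus>\<^bsub>P\<^esub> f (bracket_term (xs @ y # ys) i j)"
      using x a(2) by (simp add: eq g.hom_add f.multi_add g.hom_closed)
  next
    fix xs x ys a assume a: "xs @ x # ys \<in> tuples L n" "a \<in> carrier R"
    then have x: "x \<in> carrier L" by (simp add: tuples_def)
    from key[OF a(1)] obtain us ws g where g: "linear_map R L L g"
      and eq: "\<And>z. z \<in> carrier L \<Longrightarrow> bracket_term (xs @ z # ys) i j = us @ g z # ws" by blast
    interpret g: linear_map R L L g by fact
    have "us @ g x # ws \<in> tuples L (n - 1)"
      using bracket_term_tuples[OF a(1) ij] eq[OF x] by simp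
    then show "f (bracket_term (xs @ (a \<odot>\<^bsub>L\<^esub> x) # ys) i j)
        = a \<odot>\<^bsub>P\<^esub> f (bracket_term (xs @ x # ys) i j)"
      using x a(2) by (simp add: eq g.hom_smult f.multi_smult)
  qed
qed

text \<open>The function that \<open>ce_boundary\<close> lifts. That it is alternating, and so
  descends to the exterior power, is proved separately below for \<open>n = 3\<close> and
  \<open>n = 4\<close>.\<close>

definition boundary_tuple :: "nat \<Rightarrow> 'g list \<Rightarrow> ('g list \<Rightarrow> 'r) set set" where
  "boundary_tuple n xs = finsum (ext_power R L (n - 1))
     (\<lambda>(i, j). ((\<ominus> \<one>) [^] (i + j)) \<odot>\<^bsub>ext_power R L (n - 1)\<^esub> wedge R L (bracket_term xs i j))
     {(i, j). i < j \<and> j < n}"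

lemma ce_boundary_eq: "ce_boundary R L br n = ext_lift R (ext_power R L (n - 1)) (boundary_tuple n)"
  by (simp add: ce_boundary_def boundary_tuple_def[abs_def] bracket_term_def)

lemma boundary_tuple_multilinear: "multilinear_map R L (ext_power R L (n - 1)) n (boundary_tuple n)"
proof -
  let ?E = "ext_power R L (n - 1)"
  interpret E: module R ?E by (rule module_ext_power)
  have "multilinear_map R L ?E n
      (\<lambda>xs. \<Oplus>\<^bsub>?E\<^esub>p\<in>{(i, j). i < j \<and> j < n}.
        ((\<ominus> \<one>) [^] (fst p + snd p)) \<odot>\<^bsub>?E\<^esub> wedge R L (bracket_term xs (fst p) (snd p)))"
  proof (rule multilinear_map_finsum[OF module_axioms E.module_axioms])
    have "{(i, j). i < j \<and> j < n} \<subseteq> {..<n} \<times> {..<n}" by auto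
    then show "finite {(i, j). i < j \<and> j < n}" by (rule finite_subset) simp
  next
    fix p assume "p \<in> {(i, j). i < j \<and> j < n}"
    then show "multilinear_map R L ?E n
        (\<lambda>xs. ((\<ominus> \<one>) [^] (fst p + snd p)) \<odot>\<^bsub>?E\<^esub> wedge R L (bracket_term xs (fst p) (snd p)))"
      by (intro multilinear_map_comp[OF bracket_term_multilinear[OF
              alternating_map.axioms(1)[OF wedge_alternating]] E.linear_map_scale]) auto
  qed
  then show ?thesis by (simp add: boundary_tuple_def[abs_def] case_prod_unfold)
qed

lemma boundary_tuple_3:
  assumes "x \<in> carrier L" "y \<in> carrier L" "z \<in> carrier L"
  shows "boundary_tuple 3 [x, y, z] =
    \<ominus>\<^bsub>ext_power R L 2\<^esub> wedge R L [br x y, z] \<oplus>\<^bsub>ext_power R L 2\<^esub> (wedge R L [br x z, y]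
      \<oplus>\<^bsub>ext_power R L 2\<^esub> \<ominus>\<^bsub>ext_power R L 2\<^esub> wedge R L [br y z, x])"
proof -
  interpret E: module R "ext_power R L 2" by (rule module_ext_power)
  have cl: "wedge R L [u, v] \<in> carrier (ext_power R L 2)" if "u \<in> carrier L" "v \<in> carrier L" for u v
    using that by (intro wedge_closed) (simp add: tuples_def)
  have "{(i, j). i < j \<and> j < (3::nat)} = {(0, 1), (0, 2), (1, 2)}" by auto
  then show ?thesis
    using assms
    by (simp add: boundary_tuple_def bracket_term_def nths_Cons minus_one_power cl br_closed E.smult_l_minus)
qed

lemma boundary_tuple_4:
  assumes "x \<in> carrier L" "y \<in> carrier L" "z \<in> carrier L" "w \<in> carrier L"
  shows "boundary_tuple 4 [x, y, z, w] =
    \<ominus>\<^bsub>ext_power R L 3\<^esub> wedge R L [br x y, z, w] \<oplus>\<^bsub>ext_power R L 3\<^esub> (wedge R L [br x z, y, w]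
      \<oplus>\<^bsub>ext_power R L 3\<^esub> (\<ominus>\<^bsub>ext_power R L 3\<^esub> wedge R L [br x w, y, z]
      \<oplus>\<^bsub>ext_power R L 3\<^esub> (\<ominus>\<^bsub>ext_power R L 3\<^esub> wedge R L [br y z, x, w]
      \<oplus>\<^bsub>ext_power R L 3\<^esub> (wedge R L [br y w, x, z]
      \<oplus>\<^bsub>ext_power R L 3\<^esub> \<ominus>\<^bsub>ext_power R L 3\<^esub> wedge R L [br z w, x, y]))))"
proof -
  interpret E: module R "ext_power R L 3" by (rule module_ext_power)
  have cl: "wedge R L [u, v, t] \<in> carrier (ext_power R L 3)"
    if "u \<in> carrier L" "v \<in> carrier L" "t \<in> carrier L" for u v t
    using that by (intro wedge_closed) (simp add: tuples_def)
  have "{(i, j). i < j \<and> j < (4::nat)} = {(0, 1), (0, 2), (0, 3), (1, 2), (1, 3), (2, 3)}" by auto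
  then show ?thesis
    using assms
    by (simp add: boundary_tuple_def bracket_term_def nths_Cons minus_one_power cl br_closed E.smult_l_minus)
qed

text \<open>With two equal neighbours \<open>x\<close>, one term contains \<open>br x x = 0\<close>
  and the other two are the same wedge with opposite signs.\<close>

lemma boundary_tuple_3_alternating: "alternating_map R L (ext_power R L 2) 3 (boundary_tuple 3)"
proof -
  interpret w: alternating_map R L "ext_power R L 2" 2 "wedge R L" by (rule wedge_alternating)
  interpret b: multilinear_map R L "ext_power R L 2" 3 "boundary_tuple 3"
    using boundary_tuple_multilinear[of 3] by simp
  have cl: "wedge R L [u, v] \<in> carrier (ext_power R L 2)" if "u \<in> carrier L" "v \<in> carrier L" for u v
    using that by (intro wedge_closed) (simp add: tuples_def)
  have alt: "wedge R L [\<zero>\<^bsub>L\<^esub>, v] = \<zero>\<^bsub>ext_power R L 2\<^esub>" if "v \<in> carrier L" for v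
    using that w.multi_zero[of "[]" "[v]"] by (simp_all add: tuples_def)
  show ?thesis
  proof unfold_locales
    fix xs x ys assume a: "xs @ x # x # ys \<in> tuples L 3"
    then have "x \<in> carrier L" by (simp add: tuples_def)
    moreover obtain y where "y \<in> carrier L" "xs = [] \<and> ys = [y] \<or> xs = [y] \<and> ys = []"
      using a by (cases xs; cases ys) (auto simp: tuples_def length_Suc_conv)
    ultimately show "boundary_tuple 3 (xs @ x # x # ys) = \<zero>\<^bsub>ext_power R L 2\<^esub>"
      by (-, (elim disjE conjE; simp add: boundary_tuple_3 br_alternating alt cl br_closed
            w.P.M.r_neg w.P.M.l_neg w.P.M.neg_zero))
  qed
qed

text \<open>With two equal neighbours \<open>x\<close>, one term contains \<open>br x x = 0\<close>,
  the term bracketing the two other vectors repeats \<open>x\<close> in its wedge, and the remaining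
  four are two pairs of identical wedges with opposite signs.\<close>

lemma boundary_tuple_4_alternating: "alternating_map R L (ext_power R L 3) 4 (boundary_tuple 4)"
proof -
  interpret w: alternating_map R L "ext_power R L 3" 3 "wedge R L" by (rule wedge_alternating)
  interpret b: multilinear_map R L "ext_power R L 3" 4 "boundary_tuple 4"
    using boundary_tuple_multilinear[of 4] by simp
  have cl: "wedge R L [u, v, t] \<in> carrier (ext_power R L 3)"
    if "u \<in> carrier L" "v \<in> carrier L" "t \<in> carrier L" for u v t
    using that by (intro wedge_closed) (simp add: tuples_def)
  have alt: "wedge R L [\<zero>\<^bsub>L\<^esub>, u, v] = \<zero>\<^bsub>ext_power R L 3\<^esub>" "wedge R L [u, v, v] = \<zero>\<^bsub>ext_power R L 3\<^esub>"
    if "u \<in> carrier L" "v \<in> carrier L" for u v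
    using that w.multi_zero[of "[]" "[u, v]"] w.multi_alternating[of "[u]" v "[]"]
    by (simp_all add: tuples_def)
  show ?thesis
  proof unfold_locales
    fix xs x ys assume a: "xs @ x # x # ys \<in> tuples L 4"
    then have "x \<in> carrier L" by (simp add: tuples_def)
    moreover obtain y z where "y \<in> carrier L" "z \<in> carrier L"
        "xs = [] \<and> ys = [y, z] \<or> xs = [y] \<and> ys = [z] \<or> xs = [y, z] \<and> ys = []"
      using a by (cases xs; cases ys; cases "tl xs") (auto simp: tuples_def length_Suc_conv)
    ultimately show "boundary_tuple 4 (xs @ x # x # ys) = \<zero>\<^bsub>ext_power R L 3\<^esub>"
      by (-, (elim disjE conjE; simp add: boundary_tuple_4 br_alternating alt cl br_closed
            w.P.M.r_neg w.P.M.r_neg1 w.P.M.r_neg2 w.P.M.l_neg w.P.M.conjugate_cancel w.P.M.neg_zero))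
  qed
qed

lemma ce_boundary_3_linear: "linear_map R (ext_power R L 3) (ext_power R L 2) (ce_boundary R L br 3)"
  and ce_boundary_3_wedge: "xs \<in> tuples L 3 \<Longrightarrow> ce_boundary R L br 3 (wedge R L xs) = boundary_tuple 3 xs"
  unfolding ce_boundary_eq
  using ext_lift_linear[OF boundary_tuple_3_alternating] ext_lift_wedge[OF boundary_tuple_3_alternating]
  by simp_all

lemma ce_boundary_4_linear: "linear_map R (ext_power R L 4) (ext_power R L 3) (ce_boundary R L br 4)"
  and ce_boundary_4_wedge: "xs \<in> tuples L 4 \<Longrightarrow> ce_boundary R L br 4 (wedge R L xs) = boundary_tuple 4 xs"
  unfolding ce_boundary_eq
  using ext_lift_linear[OF boundary_tuple_4_alternating] ext_lift_wedge[OF boundary_tuple_4_alternating]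
  by simp_all

end


section \<open>The Killing module and the Koszul map\<close>

context lie_algebra
begin

text \<open>The form \<open>B\<close> of the overview.\<close>

definition killing_form :: "'g \<Rightarrow> 'g \<Rightarrow> ('g list \<Rightarrow> 'r) set set set" where
  "killing_form x y =
    kill_rel_map R L br ` carrier (tensor_power R L 3) +>\<^bsub>sym_square R L\<^esub> sym_prod R L x y"

lemma kill_rel_map_linear:
    "linear_map R (tensor_power R L 3) (sym_square R L) (kill_rel_map R L br)"
  and kill_rel_map_tensor: "\<lbrakk>x \<in> carrier L; y \<in> carrier L; z \<in> carrier L\<rbrakk>
    \<Longrightarrow> kill_rel_map R L br (tensor R L [x, y, z])
      = sym_prod R L (br x y) z \<ominus>\<^bsub>sym_square R L\<^esub> sym_prod R L x (br y z)"
proof -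
  interpret S: bilinear_map R L "sym_square R L" "sym_prod R L" by (rule sym_prod_bilinear)
  have m: "multilinear_map R L (sym_square R L) 3
      (\<lambda>xs. sym_prod R L (br (xs ! 0) (xs ! 1)) (xs ! 2)
            \<ominus>\<^bsub>sym_square R L\<^esub> sym_prod R L (xs ! 0) (br (xs ! 1) (xs ! 2)))"
  proof (rule multilinear_map_3I[OF module_axioms], goal_cases)
    case (1 y z)
    then show ?case
      by (intro linear_map_diff linear_map_comp[OF br.linear_left S.linear_left] S.linear_left br_closed)
  next
    case (2 x z)
    then show ?case
      by (intro linear_map_diff linear_map_comp[OF br.linear_right S.linear_left]
          linear_map_comp[OF br.linear_left S.linear_right])
  next
    case (3 x y)
    then show ?case
      by (intro linear_map_diff linear_map_comp[OF br.linear_right S.linear_right] S.linear_right br_closed)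
  qed
  show "linear_map R (tensor_power R L 3) (sym_square R L) (kill_rel_map R L br)"
    unfolding kill_rel_map_def by (rule tensor_lift_linear[OF m])
  show "kill_rel_map R L br (tensor R L [x, y, z])
      = sym_prod R L (br x y) z \<ominus>\<^bsub>sym_square R L\<^esub> sym_prod R L x (br y z)"
    if "x \<in> carrier L" "y \<in> carrier L" "z \<in> carrier L"
    unfolding kill_rel_map_def using that by (subst tensor_lift_tensor[OF m]) (simp_all add: tuples_def)
qed

text \<open>The relations are given as the image of a map and not as a span; linearity of
  \<open>kill_rel_map\<close> makes this image a submodule.\<close>

lemma killing_quotient_module:
  "quotient_module R (sym_square R L) (kill_rel_map R L br ` carrier (tensor_power R L 3))"
  using linear_map.image_submodule[OF kill_rel_map_linear] bilinear_map.axioms(2)[OF sym_prod_bilinear]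
  by (simp add: quotient_module_def)

lemma killing_form_bilinear: "bilinear_map R L (killing_module R L br) killing_form"
  unfolding killing_form_def[abs_def] killing_module_def
  by (rule bilinear_map_comp[OF sym_prod_bilinear quotient_module.proj_linear[OF killing_quotient_module]])

sublocale K: bilinear_map R L "killing_module R L br" killing_form
  by (rule killing_form_bilinear)

lemma killing_form_commute:
  "\<lbrakk>x \<in> carrier L; y \<in> carrier L\<rbrakk> \<Longrightarrow> killing_form x y = killing_form y x"
  unfolding killing_form_def by (simp add: sym_prod_commute)

lemma killing_form_invariant:
  assumes "x \<in> carrier L" "y \<in> carrier L" "z \<in> carrier L"
  shows "killing_form (br x y) z = killing_form x (br y z)"
proof -
  interpret S: bilinear_map R L "sym_square R L" "sym_prod R L" by (rule sym_prod_bilinear)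
  interpret q: quotient_module R "sym_square R L" "kill_rel_map R L br ` carrier (tensor_power R L 3)"
    by (rule killing_quotient_module)
  have "sym_prod R L (br x y) z \<ominus>\<^bsub>sym_square R L\<^esub> sym_prod R L x (br y z)
      \<in> kill_rel_map R L br ` carrier (tensor_power R L 3)"
    using assms kill_rel_map_tensor[OF assms, symmetric]
    by (intro image_eqI[of _ _ "tensor R L [x, y, z]"]) (simp_all add: tensor_closed tuples_def)
  then show ?thesis
    unfolding killing_form_def using assms by (simp add: q.coset_eq_iff S.bi_closed br_closed)
qed

text \<open>Invariance brings the repeated vector into one bracket:
  \<open>B(x, [x, y]) = B([x, x], y) = 0\<close>. The other position, \<open>B(y, [x, x])\<close>,
  vanishes directly.\<close>

lemma koszul_alternating:
  "alternating_map R L (killing_module R L br) 3 (\<lambda>xs. killing_form (xs ! 0) (br (xs ! 1) (xs ! 2)))"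
proof -
  interpret m: multilinear_map R L "killing_module R L br" 3
    "\<lambda>xs. killing_form (xs ! 0) (br (xs ! 1) (xs ! 2))"
  proof (rule multilinear_map_3I[OF module_axioms], goal_cases)
    case (1 y z) then show ?case by (intro K.linear_left br_closed)
  next
    case (2 x z) then show ?case by (intro linear_map_comp[OF br.linear_left K.linear_right])
  next
    case (3 x y) then show ?case by (intro linear_map_comp[OF br.linear_right K.linear_right])
  qed
  show ?thesis
  proof unfold_locales
    fix xs x ys assume a: "xs @ x # x # ys \<in> tuples L 3"
    then have x: "x \<in> carrier L" by (simp add: tuples_def)
    obtain y where y: "y \<in> carrier L" "xs = [] \<and> ys = [y] \<or> xs = [y] \<and> ys = []"
      using a by (cases xs; cases ys) (auto simp: tuples_def length_Suc_conv)
    have "killing_form x (br x y) = \<zero>\<^bsub>killing_module R L br\<^esub>"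
      using killing_form_invariant[OF x x y(1)] x y(1) by (simp add: br_alternating K.bi_zero_left)
    moreover have "killing_form y (br x x) = \<zero>\<^bsub>killing_module R L br\<^esub>"
      using x y(1) by (simp add: br_alternating K.bi_zero_right)
    ultimately show "killing_form ((xs @ x # x # ys) ! 0)
        (br ((xs @ x # x # ys) ! 1) ((xs @ x # x # ys) ! 2)) = \<zero>\<^bsub>killing_module R L br\<^esub>"
      using y(2) by (elim disjE conjE) simp_all
  qed
qed

lemma koszul_map_eq: "koszul_map R L br = ext_lift R (killing_module R L br)
    (\<lambda>xs. killing_form (xs ! 0) (br (xs ! 1) (xs ! 2)))"
  by (simp add: koszul_map_def killing_form_def)

lemma koszul_map_linear: "linear_map R (ext_power R L 3) (killing_module R L br) (koszul_map R L br)"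
  unfolding koszul_map_eq by (rule ext_lift_linear[OF koszul_alternating])

lemma koszul_map_wedge:
  "\<lbrakk>x \<in> carrier L; y \<in> carrier L; z \<in> carrier L\<rbrakk>
    \<Longrightarrow> koszul_map R L br (wedge R L [x, y, z]) = killing_form x (br y z)"
  unfolding koszul_map_eq by (subst ext_lift_wedge[OF koszul_alternating]) (simp_all add: tuples_def)

text \<open>The six terms of the boundary of a 4-vector pair up, and the Jacobi identity kills the sum.\<close>

lemma koszul_map_boundary:
  assumes c: "c \<in> carrier (ext_power R L 4)"
  shows "koszul_map R L br (ce_boundary R L br 4 c) = \<zero>\<^bsub>killing_module R L br\<^esub>"
proof (rule ext_power_eqI[OF linear_map_comp[OF ce_boundary_4_linear koszul_map_linear]
      module.linear_map_zero[OF module_ext_power K.P.module_axioms] _ c])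
  fix xs assume xs: "xs \<in> tuples L 4"
  then obtain x y z w where eq: "xs = [x, y, z, w]"
    by (auto simp: tuples_def length_Suc_conv numeral_eq_Suc)
  then have cl: "x \<in> carrier L" "y \<in> carrier L" "z \<in> carrier L" "w \<in> carrier L"
    using xs by (auto simp: tuples_def)
  interpret h: linear_map R "ext_power R L 3" "killing_module R L br" "koszul_map R L br"
    by (rule koszul_map_linear)
  have w: "wedge R L [u, v, t] \<in> carrier (ext_power R L 3)"
    if "u \<in> carrier L" "v \<in> carrier L" "t \<in> carrier L" for u v t
    using that by (intro wedge_closed) (simp add: tuples_def)
  let ?K = "killing_module R L br"
  let ?a = "killing_form (br x y) (br z w)" and ?b = "killing_form (br x z) (br y w)"
    and ?c = "killing_form (br x w) (br y z)"
  have Kcl: "?a \<in> carrier ?K" "?b \<in> carrier ?K" "?c \<in> carrier ?K"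
    using cl by (simp_all add: K.bi_closed br_closed)
  have "br z (br w y) = \<ominus>\<^bsub>L\<^esub> br z (br y w)"
    using cl by (simp add: br_skew[of w y] br.bi_neg_right br_closed)
  \<comment> \<open>Pairing \<open>x\<close> with the Jacobi identity for \<open>y\<close>,
    \<open>z\<close>, \<open>w\<close> and moving the outer brackets across by invariance gives
    \<open>a - b + c = 0\<close>. The six boundary terms add up to
    \<open>2(b - a - c)\<close>.\<close>
  then have "killing_form x (br y (br z w) \<oplus>\<^bsub>L\<^esub> \<ominus>\<^bsub>L\<^esub> br z (br y w) \<oplus>\<^bsub>L\<^esub> br w (br y z)) = \<zero>\<^bsub>?K\<^esub>"
    using cl br_jacobi[of y z w] by (simp add: K.bi_zero_right)
  then have "?a \<oplus>\<^bsub>?K\<^esub> \<ominus>\<^bsub>?K\<^esub> ?b \<oplus>\<^bsub>?K\<^esub> ?c = \<zero>\<^bsub>?K\<^esub>"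
    using cl by (simp add: killing_form_invariant br_closed K.bi_add_right K.bi_neg_right)
  then have b: "?b = ?a \<oplus>\<^bsub>?K\<^esub> ?c"
    using Kcl by (metis K.P.M.a_assoc K.P.M.a_comm K.P.M.add.inv_closed K.P.M.add.m_closed
        K.P.M.minus_equality K.P.M.minus_minus)
  have "koszul_map R L br (ce_boundary R L br 4 (wedge R L [x, y, z, w]))
      = \<ominus>\<^bsub>?K\<^esub> ?a \<oplus>\<^bsub>?K\<^esub> (?b \<oplus>\<^bsub>?K\<^esub> (\<ominus>\<^bsub>?K\<^esub> ?c \<oplus>\<^bsub>?K\<^esub> (\<ominus>\<^bsub>?K\<^esub> ?c \<oplus>\<^bsub>?K\<^esub> (?b \<oplus>\<^bsub>?K\<^esub> \<ominus>\<^bsub>?K\<^esub> ?a))))"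
    using cl xs eq killing_form_commute[of "br y z" "br x w"] killing_form_commute[of "br y w" "br x z"]
      killing_form_commute[of "br z w" "br x y"]
    by (simp add: ce_boundary_4_wedge boundary_tuple_4 h.hom_add h.hom_neg w br_closed koszul_map_wedge)
  also have "\<dots> = \<zero>\<^bsub>?K\<^esub>"
    unfolding b using Kcl by (simp add: K.P.M.a_assoc K.P.M.r_neg1 K.P.M.r_neg2 K.P.M.conjugate_cancel K.P.M.r_neg K.P.M.l_neg)
  finally show "koszul_map R L br (ce_boundary R L br 4 (wedge R L xs)) = \<zero>\<^bsub>?K\<^esub>"
    by (simp add: eq)
qed

end


section \<open>Gradings\<close>

context graded_lie_algebra
begin

section \<open>Homogeneous components and the operator that scales them\<close>

definition is_decomposition :: "'g \<Rightarrow> ('a \<Rightarrow> 'g) \<Rightarrow> bool" where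
  "is_decomposition x u \<longleftrightarrow> (\<forall>\<alpha>\<in>carrier A. u \<alpha> \<in> Gr \<alpha>) \<and> (\<forall>\<alpha>. \<alpha> \<notin> carrier A \<longrightarrow> u \<alpha> = \<zero>\<^bsub>L\<^esub>)
     \<and> finite {\<alpha>. u \<alpha> \<noteq> \<zero>\<^bsub>L\<^esub>} \<and> x = (\<Oplus>\<^bsub>L\<^esub>\<alpha>\<in>{\<alpha>. u \<alpha> \<noteq> \<zero>\<^bsub>L\<^esub>}. u \<alpha>)"

definition components :: "'g \<Rightarrow> 'a \<Rightarrow> 'g" where
  "components x = (THE u. is_decomposition x u)"

text \<open>For \<open>c = \<phi>\<close> this is the derivation \<open>D\<close> of the
  overview.\<close>

definition weight_map :: "('a \<Rightarrow> 'r) \<Rightarrow> 'g \<Rightarrow> 'g" where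
  "weight_map c x = (\<Oplus>\<^bsub>L\<^esub>\<alpha>\<in>{\<alpha>. components x \<alpha> \<noteq> \<zero>\<^bsub>L\<^esub>}. c \<alpha> \<odot>\<^bsub>L\<^esub> components x \<alpha>)"

lemma ex1_decomposition: "x \<in> carrier L \<Longrightarrow> \<exists>!u. is_decomposition x u"
  unfolding is_decomposition_def by (rule direct_sum)

lemma is_decomposition_components: "x \<in> carrier L \<Longrightarrow> is_decomposition x (components x)"
  unfolding components_def by (rule theI'[OF ex1_decomposition])

lemma components_eq: "\<lbrakk>x \<in> carrier L; is_decomposition x u\<rbrakk> \<Longrightarrow> components x = u"
  unfolding components_def by (rule the1_equality[OF ex1_decomposition])

lemma homogeneous_closed: "\<lbrakk>\<alpha> \<in> carrier A; x \<in> Gr \<alpha>\<rbrakk> \<Longrightarrow> x \<in> carrier L"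
  using submoduleE(1)[OF graded_submodule] by blast

lemma decomposition_closed: "is_decomposition x u \<Longrightarrow> u \<alpha> \<in> carrier L"
  unfolding is_decomposition_def by (metis M.zero_closed homogeneous_closed)

text \<open>Lets sums over different supports be compared on one index set. \<open>T\<close> stays
  inside \<open>carrier A\<close> because \<open>c\<close> is only known to take values in
  \<open>R\<close> there.\<close>

lemma decomposition_sum:
  assumes u: "is_decomposition x u" and c: "c \<in> carrier A \<rightarrow> carrier R"
    and T: "finite T" "{\<alpha>. u \<alpha> \<noteq> \<zero>\<^bsub>L\<^esub>} \<subseteq> T" "T \<subseteq> carrier A"
  shows "(\<Oplus>\<^bsub>L\<^esub>\<alpha>\<in>{\<alpha>. u \<alpha> \<noteq> \<zero>\<^bsub>L\<^esub>}. c \<alpha> \<odot>\<^bsub>L\<^esub> u \<alpha>) = (\<Oplus>\<^bsub>L\<^esub>\<alpha>\<in>T. c \<alpha> \<odot>\<^bsub>L\<^esub> u \<alpha>)"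
proof (rule M.add.finprod_mono_neutral_cong_left[OF T(1,2)])
  show "c \<alpha> \<odot>\<^bsub>L\<^esub> u \<alpha> = \<zero>\<^bsub>L\<^esub>" if "\<alpha> \<in> T - {\<alpha>. u \<alpha> \<noteq> \<zero>\<^bsub>L\<^esub>}" for \<alpha>
    using c T(3) that by (simp add: Pi_iff subset_iff)
  show "(\<lambda>\<alpha>. c \<alpha> \<odot>\<^bsub>L\<^esub> u \<alpha>) \<in> T \<rightarrow> carrier L"
    using c T(3) decomposition_closed[OF u] by (simp add: Pi_iff subset_iff)
qed simp

lemma decomposition_sum_one:
  assumes u: "is_decomposition x u" and T: "finite T" "{\<alpha>. u \<alpha> \<noteq> \<zero>\<^bsub>L\<^esub>} \<subseteq> T" "T \<subseteq> carrier A"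
  shows "x = (\<Oplus>\<^bsub>L\<^esub>\<alpha>\<in>T. u \<alpha>)"
proof -
  \<comment> \<open>The plain sum is the weighted sum with constant weight
    \<open>\<one>\<close>.\<close>
  have "(\<lambda>_. \<one>) \<in> carrier A \<rightarrow> carrier R" by simp
  from decomposition_sum[OF u this T] show ?thesis
    using u decomposition_closed[OF u] by (simp add: is_decomposition_def)
qed

lemma weight_map_eq:
  assumes "x \<in> carrier L" "is_decomposition x u" "c \<in> carrier A \<rightarrow> carrier R"
    and "finite T" "{\<alpha>. u \<alpha> \<noteq> \<zero>\<^bsub>L\<^esub>} \<subseteq> T" "T \<subseteq> carrier A"
  shows "weight_map c x = (\<Oplus>\<^bsub>L\<^esub>\<alpha>\<in>T. c \<alpha> \<odot>\<^bsub>L\<^esub> u \<alpha>)"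
  unfolding weight_map_def components_eq[OF assms(1,2)] by (rule decomposition_sum[OF assms(2-6)])

lemma decomposition_support:
  "is_decomposition x u \<Longrightarrow> finite {\<alpha>. u \<alpha> \<noteq> \<zero>\<^bsub>L\<^esub>} \<and> {\<alpha>. u \<alpha> \<noteq> \<zero>\<^bsub>L\<^esub>} \<subseteq> carrier A"
  by (auto simp: is_decomposition_def)

lemma is_decompositionI:
  assumes "\<And>\<alpha>. \<alpha> \<in> carrier A \<Longrightarrow> u \<alpha> \<in> Gr \<alpha>" "finite T" "T \<subseteq> carrier A"
    "\<And>\<alpha>. \<alpha> \<notin> T \<Longrightarrow> u \<alpha> = \<zero>\<^bsub>L\<^esub>" "x = (\<Oplus>\<^bsub>L\<^esub>\<alpha>\<in>T. u \<alpha>)"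
  shows "is_decomposition x u"
proof -
  have sub: "{\<alpha>. u \<alpha> \<noteq> \<zero>\<^bsub>L\<^esub>} \<subseteq> T" using assms(4) by auto
  have "(\<Oplus>\<^bsub>L\<^esub>\<alpha>\<in>{\<alpha>. u \<alpha> \<noteq> \<zero>\<^bsub>L\<^esub>}. u \<alpha>) = (\<Oplus>\<^bsub>L\<^esub>\<alpha>\<in>T. u \<alpha>)"
    by (rule M.add.finprod_mono_neutral_cong_left[OF assms(2) sub])
      (use assms(1,3) homogeneous_closed in \<open>auto simp: Pi_iff subset_iff\<close>)
  then show ?thesis
    using assms finite_subset[OF sub assms(2)] by (auto simp: is_decomposition_def)
qed

text \<open>By uniqueness of decompositions, this lemma and its scalar counterpart make the
  components depend linearly on the vector; linearity of \<open>weight_map\<close> follows from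
  that.\<close>

lemma is_decomposition_add:
  assumes "is_decomposition x u" "is_decomposition y v"
  shows "is_decomposition (x \<oplus>\<^bsub>L\<^esub> y) (\<lambda>\<alpha>. u \<alpha> \<oplus>\<^bsub>L\<^esub> v \<alpha>)"
proof (rule is_decompositionI)
  let ?T = "{\<alpha>. u \<alpha> \<noteq> \<zero>\<^bsub>L\<^esub>} \<union> {\<alpha>. v \<alpha> \<noteq> \<zero>\<^bsub>L\<^esub>}"
  show T: "finite ?T" "?T \<subseteq> carrier A"
    using decomposition_support[OF assms(1)] decomposition_support[OF assms(2)] by auto
  show "x \<oplus>\<^bsub>L\<^esub> y = (\<Oplus>\<^bsub>L\<^esub>\<alpha>\<in>?T. u \<alpha> \<oplus>\<^bsub>L\<^esub> v \<alpha>)"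
    using decomposition_sum_one[OF assms(1) T(1) _ T(2)] decomposition_sum_one[OF assms(2) T(1) _ T(2)]
      decomposition_closed[OF assms(1)] decomposition_closed[OF assms(2)]
    by (simp add: M.finsum_addf Pi_iff)
qed (use assms in \<open>auto simp: is_decomposition_def submoduleE(5)[OF graded_submodule]\<close>)

lemma is_decomposition_smult:
  assumes "is_decomposition x u" "a \<in> carrier R"
  shows "is_decomposition (a \<odot>\<^bsub>L\<^esub> x) (\<lambda>\<alpha>. a \<odot>\<^bsub>L\<^esub> u \<alpha>)"
proof (rule is_decompositionI)
  let ?T = "{\<alpha>. u \<alpha> \<noteq> \<zero>\<^bsub>L\<^esub>}"
  show T: "finite ?T" "?T \<subseteq> carrier A"
    using decomposition_support[OF assms(1)] by auto
  show "a \<odot>\<^bsub>L\<^esub> x = (\<Oplus>\<^bsub>L\<^esub>\<alpha>\<in>?T. a \<odot>\<^bsub>L\<^esub> u \<alpha>)"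
    using decomposition_sum_one[OF assms(1) T(1) _ T(2)] decomposition_closed[OF assms(1)]
      finsum_smult_ldistr[OF T(1) assms(2), of u] by (simp add: Pi_iff)
qed (use assms in \<open>auto simp: is_decomposition_def submoduleE(4)[OF graded_submodule]\<close>)

lemma weight_map_linear:
  assumes c: "c \<in> carrier A \<rightarrow> carrier R"
  shows "linear_map R L L (weight_map c)"
proof unfold_locales
  fix x assume x: "x \<in> carrier L"
  let ?u = "components x" and ?T = "{\<alpha>. components x \<alpha> \<noteq> \<zero>\<^bsub>L\<^esub>}"
  note u = is_decomposition_components[OF x]
  have T: "finite ?T" "?T \<subseteq> carrier A" using decomposition_support[OF u] by auto
  have cu: "(\<lambda>\<alpha>. c \<alpha> \<odot>\<^bsub>L\<^esub> ?u \<alpha>) \<in> ?T \<rightarrow> carrier L"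
    using c T decomposition_closed[OF u] by (auto simp: Pi_iff)
  show "weight_map c x \<in> carrier L"
    unfolding weight_map_def using cu by (rule M.finsum_closed)
  fix a assume a: "a \<in> carrier R"
  have "weight_map c (a \<odot>\<^bsub>L\<^esub> x) = (\<Oplus>\<^bsub>L\<^esub>\<alpha>\<in>?T. c \<alpha> \<odot>\<^bsub>L\<^esub> (a \<odot>\<^bsub>L\<^esub> ?u \<alpha>))"
    by (rule weight_map_eq[OF _ is_decomposition_smult[OF u a] c T(1) _ T(2)]) (use a x in auto)
  also have "\<dots> = (\<Oplus>\<^bsub>L\<^esub>\<alpha>\<in>?T. a \<odot>\<^bsub>L\<^esub> (c \<alpha> \<odot>\<^bsub>L\<^esub> ?u \<alpha>))"
  proof (rule M.finsum_cong')
    fix \<alpha> assume "\<alpha> \<in> ?T"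
    then have "c \<alpha> \<in> carrier R" using c T(2) by auto
    then show "c \<alpha> \<odot>\<^bsub>L\<^esub> (a \<odot>\<^bsub>L\<^esub> ?u \<alpha>) = a \<odot>\<^bsub>L\<^esub> (c \<alpha> \<odot>\<^bsub>L\<^esub> ?u \<alpha>)"
      using a decomposition_closed[OF u] by (simp add: smult_assoc1[symmetric] R.m_comm)
  qed (use a cu in auto)
  also have "\<dots> = a \<odot>\<^bsub>L\<^esub> weight_map c x"
    unfolding weight_map_def by (rule finsum_smult_ldistr[symmetric, OF T(1) a cu])
  finally show "weight_map c (a \<odot>\<^bsub>L\<^esub> x) = a \<odot>\<^bsub>L\<^esub> weight_map c x" .
next
  fix x y assume x: "x \<in> carrier L" and y: "y \<in> carrier L"
  note u = is_decomposition_components[OF x] and v = is_decomposition_components[OF y]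
  let ?u = "components x" and ?v = "components y"
  let ?T = "{\<alpha>. ?u \<alpha> \<noteq> \<zero>\<^bsub>L\<^esub>} \<union> {\<alpha>. ?v \<alpha> \<noteq> \<zero>\<^bsub>L\<^esub>}"
  have T: "finite ?T" "?T \<subseteq> carrier A"
    using decomposition_support[OF u] decomposition_support[OF v] by auto
  have cT: "c \<alpha> \<in> carrier R" if "\<alpha> \<in> ?T" for \<alpha> using c T(2) that by blast
  have "weight_map c (x \<oplus>\<^bsub>L\<^esub> y) = (\<Oplus>\<^bsub>L\<^esub>\<alpha>\<in>?T. c \<alpha> \<odot>\<^bsub>L\<^esub> (?u \<alpha> \<oplus>\<^bsub>L\<^esub> ?v \<alpha>))"
    by (rule weight_map_eq[OF _ is_decomposition_add[OF u v] c T(1) _ T(2)]) (use x y in auto)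
  also have "\<dots> = (\<Oplus>\<^bsub>L\<^esub>\<alpha>\<in>?T. c \<alpha> \<odot>\<^bsub>L\<^esub> ?u \<alpha> \<oplus>\<^bsub>L\<^esub> c \<alpha> \<odot>\<^bsub>L\<^esub> ?v \<alpha>)"
    using cT decomposition_closed[OF u] decomposition_closed[OF v]
    by (intro M.finsum_cong') (simp_all add: smult_r_distr Pi_iff)
  also have "\<dots> = (\<Oplus>\<^bsub>L\<^esub>\<alpha>\<in>?T. c \<alpha> \<odot>\<^bsub>L\<^esub> ?u \<alpha>) \<oplus>\<^bsub>L\<^esub> (\<Oplus>\<^bsub>L\<^esub>\<alpha>\<in>?T. c \<alpha> \<odot>\<^bsub>L\<^esub> ?v \<alpha>)"
    using cT decomposition_closed[OF u] decomposition_closed[OF v]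
    by (intro M.finsum_addf) (simp_all add: Pi_iff)
  also have "\<dots> = weight_map c x \<oplus>\<^bsub>L\<^esub> weight_map c y"
    using weight_map_eq[OF x u c T(1) _ T(2)] weight_map_eq[OF y v c T(1) _ T(2)] by simp
  finally show "weight_map c (x \<oplus>\<^bsub>L\<^esub> y) = weight_map c x \<oplus>\<^bsub>L\<^esub> weight_map c y" .
qed

lemma weight_map_homogeneous:
  assumes c: "c \<in> carrier A \<rightarrow> carrier R" and \<alpha>: "\<alpha> \<in> carrier A" "x \<in> Gr \<alpha>"
  shows "weight_map c x = c \<alpha> \<odot>\<^bsub>L\<^esub> x"
proof -
  let ?u = "\<lambda>\<beta>. if \<beta> = \<alpha> then x else \<zero>\<^bsub>L\<^esub>"
  have x: "x \<in> carrier L" using \<alpha> by (rule homogeneous_closed)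
  have "is_decomposition x ?u"
    \<comment> \<open>The index set \<open>{\<alpha>}\<close> also covers \<open>x = 0\<close>,
      whose support is empty.\<close>
    by (rule is_decompositionI[of _ "{\<alpha>}"])
      (use \<alpha> x in \<open>auto simp: submodule_zero[OF graded_submodule]\<close>)
  then have "weight_map c x = (\<Oplus>\<^bsub>L\<^esub>\<beta>\<in>{\<alpha>}. c \<beta> \<odot>\<^bsub>L\<^esub> ?u \<beta>)"
    by (rule weight_map_eq[OF x _ c]) (use \<alpha> in auto)
  also have "\<dots> = c \<alpha> \<odot>\<^bsub>L\<^esub> x"
    using c \<alpha>(1) x by (simp add: Pi_iff)
  finally show ?thesis .
qed

section \<open>The twisted form and its values on boundaries\<close>

text \<open>The form \<open>\<omega>\<close> of the overview, with \<open>weight_map c\<close> as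
  \<open>D\<close>.\<close>

definition twisted_form :: "('a \<Rightarrow> 'r) \<Rightarrow> 'g \<Rightarrow> 'g \<Rightarrow> ('g list \<Rightarrow> 'r) set set set" where
  "twisted_form c x y =
    killing_form x (weight_map c y) \<ominus>\<^bsub>killing_module R L br\<^esub> killing_form (weight_map c x) y"

text \<open>Bilinearity comes from linearity of \<open>weight_map\<close>. On equal arguments the
  two terms \<open>B(x, D x)\<close> and \<open>B(D x, x)\<close> cancel by symmetry of
  \<open>B\<close>, so the form is alternating and not merely antisymmetric.\<close>

lemma twisted_form_alternating:
  assumes c: "c \<in> carrier A \<rightarrow> carrier R"
  shows "alternating_map R L (killing_module R L br) 2 (\<lambda>xs. twisted_form c (xs ! 0) (xs ! 1))"
proof -
  interpret D: linear_map R L L "weight_map c" by (rule weight_map_linear[OF c])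
  interpret t: bilinear_map R L "killing_module R L br" "twisted_form c"
    unfolding twisted_form_def[abs_def]
    by unfold_locales
      (simp_all add: D.hom_closed K.bi_closed D.hom_add D.hom_smult K.bi_add_left K.bi_add_right
        K.bi_smult_left K.bi_smult_right a_minus_def K.P.M.minus_add K.P.M.a_ac
        K.P.smult_r_distr K.P.smult_r_minus)
  interpret m: multilinear_map R L "killing_module R L br" 2 "\<lambda>xs. twisted_form c (xs ! 0) (xs ! 1)"
    by (rule t.multilinear)
  show ?thesis
  proof unfold_locales
    fix xs x ys assume "xs @ x # x # ys \<in> tuples L 2"
    then have "xs = []" "x \<in> carrier L" by (auto simp: tuples_def)
    then show "twisted_form c ((xs @ x # x # ys) ! 0) ((xs @ x # x # ys) ! 1) = \<zero>\<^bsub>killing_module R L br\<^esub>"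
      using killing_form_commute[of x "weight_map c x"]
      by (simp add: twisted_form_def D.hom_closed K.bi_closed a_minus_def K.P.M.r_neg)
  qed
qed

definition twisted_lift :: "('a \<Rightarrow> 'r) \<Rightarrow> ('g list \<Rightarrow> 'r) set set \<Rightarrow> ('g list \<Rightarrow> 'r) set set set" where
  "twisted_lift c = ext_lift R (killing_module R L br) (\<lambda>xs. twisted_form c (xs ! 0) (xs ! 1))"

lemma
  assumes c: "c \<in> carrier A \<rightarrow> carrier R"
  shows twisted_lift_linear: "linear_map R (ext_power R L 2) (killing_module R L br) (twisted_lift c)"
    and twisted_lift_wedge: "\<lbrakk>x \<in> carrier L; y \<in> carrier L\<rbrakk>
      \<Longrightarrow> twisted_lift c (wedge R L [x, y]) = twisted_form c x y"
  unfolding twisted_lift_def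
  using ext_lift_linear[OF twisted_form_alternating[OF c]]
    ext_lift_wedge[OF twisted_form_alternating[OF c], of "[x, y]"]
  by (simp_all add: tuples_def)

text \<open>Every term of the boundary evaluates to a multiple of \<open>t = B(x, [y, z])\<close>.
  Writing \<open>p\<close>, \<open>q\<close>, \<open>r\<close> for the weights of \<open>x\<close>,
  \<open>y\<close>, \<open>z\<close>, the brackets of \<open>x, y\<close>, of \<open>x, z\<close>
  and of \<open>y, z\<close> contribute \<open>p + q - r\<close>, \<open>p - q + r\<close> and
  \<open>- p + q + r\<close>, whose sum is the total weight \<open>p + q + r\<close>.\<close>

lemma koszul_map_weight:
  assumes c: "c \<in> carrier A \<rightarrow> carrier R"
    and add: "\<And>\<alpha> \<beta>. \<lbrakk>\<alpha> \<in> carrier A; \<beta> \<in> carrier A\<rbrakk> \<Longrightarrow> c (\<alpha> \<otimes>\<^bsub>A\<^esub> \<beta>) = c \<alpha> \<oplus> c \<beta>"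
    and \<alpha>: "\<alpha> \<in> carrier A" "\<beta> \<in> carrier A" "\<gamma> \<in> carrier A"
    and x: "x \<in> Gr \<alpha>" "y \<in> Gr \<beta>" "z \<in> Gr \<gamma>"
  shows "twisted_lift c (ce_boundary R L br 3 (wedge R L [x, y, z]))
    = (c \<alpha> \<oplus> (c \<beta> \<oplus> c \<gamma>)) \<odot>\<^bsub>killing_module R L br\<^esub> koszul_map R L br (wedge R L [x, y, z])"
proof -
  let ?K = "killing_module R L br"
  interpret h: linear_map R "ext_power R L 2" ?K "twisted_lift c"
    by (rule twisted_lift_linear[OF c])
  have cl: "x \<in> carrier L" "y \<in> carrier L" "z \<in> carrier L"
    using \<alpha> x homogeneous_closed by auto
  have cc: "c \<alpha> \<in> carrier R" "c \<beta> \<in> carrier R" "c \<gamma> \<in> carrier R" using c \<alpha> by auto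
  have w: "wedge R L [u, v] \<in> carrier (ext_power R L 2)" if "u \<in> carrier L" "v \<in> carrier L" for u v
    using that by (intro wedge_closed) (simp add: tuples_def)
  let ?t = "killing_form x (br y z)"
  have t: "?t \<in> carrier ?K" using cl by (simp add: K.bi_closed br_closed)
  \<comment> \<open>The minus sign in the middle equation comes from
    \<open>[z, y] = - [y, z]\<close> after invariance; the last equation is symmetry of
    \<open>B\<close>.\<close>
  have k: "killing_form (br x y) z = ?t" "killing_form (br x z) y = \<ominus>\<^bsub>?K\<^esub> ?t" "killing_form (br y z) x = ?t"
    using cl br_skew[of z y] killing_form_commute[of "br y z" x]
    by (simp_all add: killing_form_invariant br_closed K.bi_neg_right)
  \<comment> \<open>Here the derivation property enters, in the form needed: a bracket of
    homogeneous vectors is homogeneous, and additivity of \<open>c\<close> makes its weight the sum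
    of the two weights.\<close>
  have D: "weight_map c x = c \<alpha> \<odot>\<^bsub>L\<^esub> x" "weight_map c y = c \<beta> \<odot>\<^bsub>L\<^esub> y" "weight_map c z = c \<gamma> \<odot>\<^bsub>L\<^esub> z"
    "weight_map c (br x y) = (c \<alpha> \<oplus> c \<beta>) \<odot>\<^bsub>L\<^esub> br x y"
    "weight_map c (br x z) = (c \<alpha> \<oplus> c \<gamma>) \<odot>\<^bsub>L\<^esub> br x z"
    "weight_map c (br y z) = (c \<beta> \<oplus> c \<gamma>) \<odot>\<^bsub>L\<^esub> br y z"
    using weight_map_homogeneous[OF c] br_graded \<alpha> x A.m_closed by (simp_all add: add[symmetric])
  have "twisted_lift c (ce_boundary R L br 3 (wedge R L [x, y, z]))
    = \<ominus>\<^bsub>?K\<^esub> twisted_form c (br x y) z \<oplus>\<^bsub>?K\<^esub> (twisted_form c (br x z) y \<oplus>\<^bsub>?K\<^esub> \<ominus>\<^bsub>?K\<^esub> twisted_form c (br y z) x)"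
    using cl by (subst ce_boundary_3_wedge)
      (simp_all add: tuples_def boundary_tuple_3 h.hom_add h.hom_neg w twisted_lift_wedge[OF c] br_closed)
  also have "twisted_form c (br x y) z = c \<gamma> \<odot>\<^bsub>?K\<^esub> ?t \<oplus>\<^bsub>?K\<^esub> \<ominus>\<^bsub>?K\<^esub> (c \<alpha> \<odot>\<^bsub>?K\<^esub> ?t \<oplus>\<^bsub>?K\<^esub> c \<beta> \<odot>\<^bsub>?K\<^esub> ?t)"
    using cl cc t by (simp add: twisted_form_def D K.bi_smult_left K.bi_smult_right br_closed k
        K.P.smult_l_distr a_minus_def)
  also have "twisted_form c (br x z) y = \<ominus>\<^bsub>?K\<^esub> (c \<beta> \<odot>\<^bsub>?K\<^esub> ?t) \<oplus>\<^bsub>?K\<^esub> (c \<alpha> \<odot>\<^bsub>?K\<^esub> ?t \<oplus>\<^bsub>?K\<^esub> c \<gamma> \<odot>\<^bsub>?K\<^esub> ?t)"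
    using cl cc t by (simp add: twisted_form_def D K.bi_smult_left K.bi_smult_right br_closed k
        K.P.smult_l_distr a_minus_def K.P.smult_r_minus K.P.M.minus_add)
  also have "twisted_form c (br y z) x = c \<alpha> \<odot>\<^bsub>?K\<^esub> ?t \<oplus>\<^bsub>?K\<^esub> \<ominus>\<^bsub>?K\<^esub> (c \<beta> \<odot>\<^bsub>?K\<^esub> ?t \<oplus>\<^bsub>?K\<^esub> c \<gamma> \<odot>\<^bsub>?K\<^esub> ?t)"
    using cl cc t by (simp add: twisted_form_def D K.bi_smult_left K.bi_smult_right br_closed k
        K.P.smult_l_distr a_minus_def)
  finally show ?thesis
    using cl cc t by (simp add: koszul_map_wedge K.P.smult_l_distr K.P.M.cyclic_cancel)
qed

text \<open>On a wedge of homogeneous vectors the total weight is \<open>c \<alpha>\<close>, the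
  same for all generators of degree \<alpha>. Two linear maps therefore agree on the whole
  degree-\<alpha> part, and on a cycle the one that factors through the boundary is zero.\<close>

lemma koszul_map_weight_cycle:
  assumes c: "c \<in> carrier A \<rightarrow> carrier R"
    and add: "\<And>\<alpha> \<beta>. \<lbrakk>\<alpha> \<in> carrier A; \<beta> \<in> carrier A\<rbrakk> \<Longrightarrow> c (\<alpha> \<otimes>\<^bsub>A\<^esub> \<beta>) = c \<alpha> \<oplus> c \<beta>"
    and \<alpha>: "\<alpha> \<in> carrier A" and z: "z \<in> ce_cycles R L br 3" "z \<in> ext_power_deg R L A Gr 3 \<alpha>"
  shows "c \<alpha> \<odot>\<^bsub>killing_module R L br\<^esub> koszul_map R L br z = \<zero>\<^bsub>killing_module R L br\<^esub>"
proof -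
  let ?K = "killing_module R L br" and ?E = "ext_power R L 3"
  let ?S = "{wedge R L xs | xs \<alpha>s. length xs = 3 \<and> set \<alpha>s \<subseteq> carrier A
         \<and> list_all2 (\<lambda>x \<beta>. x \<in> Gr \<beta>) xs \<alpha>s \<and> foldr (\<otimes>\<^bsub>A\<^esub>) \<alpha>s \<one>\<^bsub>A\<^esub> = \<alpha>}"
  interpret W: linear_map R "ext_power R L 2" ?K "twisted_lift c"
    by (rule twisted_lift_linear[OF c])
  \<comment> \<open>Membership in the carrier is proved along with the equation because agreement on
    a span requires generators inside the module.\<close>
  have S: "s \<in> carrier ?E \<and> twisted_lift c (ce_boundary R L br 3 s) = c \<alpha> \<odot>\<^bsub>?K\<^esub> koszul_map R L br s" if s: "s \<in> ?S" for s
  proof -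
    from s obtain xs \<alpha>s where xs: "s = wedge R L xs" "length xs = 3" "set \<alpha>s \<subseteq> carrier A"
      "list_all2 (\<lambda>x \<beta>. x \<in> Gr \<beta>) xs \<alpha>s" "foldr (\<otimes>\<^bsub>A\<^esub>) \<alpha>s \<one>\<^bsub>A\<^esub> = \<alpha>" by blast
    then obtain x y w where x: "xs = [x, y, w]" by (auto simp: length_Suc_conv numeral_eq_Suc)
    with xs(4) obtain a b d where a: "\<alpha>s = [a, b, d]" "x \<in> Gr a" "y \<in> Gr b" "w \<in> Gr d"
      by (auto simp: list_all2_Cons1)
    with xs(3,5) have deg: "a \<in> carrier A" "b \<in> carrier A" "d \<in> carrier A" "\<alpha> = a \<otimes>\<^bsub>A\<^esub> (b \<otimes>\<^bsub>A\<^esub> d)" by auto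
    have "wedge R L [x, y, w] \<in> carrier ?E"
      using a deg homogeneous_closed by (intro wedge_closed) (auto simp: tuples_def)
    moreover have "c \<alpha> = c a \<oplus> (c b \<oplus> c d)"
      using deg by (simp add: add)
    ultimately show ?thesis
      using koszul_map_weight[OF c add deg(1-3) a(2-4)] by (simp add: xs(1) x)
  qed
  have lin: "linear_map R ?E ?K (\<lambda>s. twisted_lift c (ce_boundary R L br 3 s))"
      "linear_map R ?E ?K (\<lambda>s. c \<alpha> \<odot>\<^bsub>?K\<^esub> koszul_map R L br s)"
    using c \<alpha> by (auto intro!: linear_map_comp[OF ce_boundary_3_linear W.linear_map_axioms]
        linear_map_comp[OF koszul_map_linear K.P.linear_map_scale])
  have "?S \<subseteq> carrier ?E" using S by blast
  then have "twisted_lift c (ce_boundary R L br 3 z) = c \<alpha> \<odot>\<^bsub>?K\<^esub> koszul_map R L br z"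
    by (rule linear_map_eq_on_span[OF lin _ conjunct2[OF S]]) (use z(2) in \<open>simp_all only: ext_power_deg_def\<close>)
  moreover have "ce_boundary R L br 3 z = \<zero>\<^bsub>ext_power R L 2\<^esub>"
    using z(1) by (simp add: ce_cycles_def a_kernel_def')
  ultimately show ?thesis by (simp add: W.hom_zero)
qed

section \<open>Passage to homology classes\<close>

text \<open>Two representatives of the class differ by a 3-boundary, which \<open>koszul_map\<close>
  kills; so the image of the nonempty coset is a singleton, as \<open>quot_lift\<close>
  requires.\<close>

lemma reduced_koszul_map_class:
  assumes z: "z \<in> ce_cycles R L br 3"
  shows "reduced_koszul_map R L br (ce_boundaries R L br 3 +>\<^bsub>ext_power R L 3\<^esub> z) = koszul_map R L br z"
proof -
  interpret h: linear_map R "ext_power R L 3" "killing_module R L br" "koszul_map R L br"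
    by (rule koszul_map_linear)
  interpret d: linear_map R "ext_power R L 4" "ext_power R L 3" "ce_boundary R L br 4"
    by (rule ce_boundary_4_linear)
  have zE: "z \<in> carrier (ext_power R L 3)"
    using z by (simp add: ce_cycles_def a_kernel_def')
  have "koszul_map R L br v = koszul_map R L br z"
    if "v \<in> ce_boundaries R L br 3 +>\<^bsub>ext_power R L 3\<^esub> z" for v
  proof -
    obtain e where "e \<in> carrier (ext_power R L 4)" "v = ce_boundary R L br 4 e \<oplus>\<^bsub>ext_power R L 3\<^esub> z"
      using \<open>v \<in> _\<close> by (auto simp: a_r_coset_def' ce_boundaries_def)
    then show ?thesis
      using zE by (simp add: h.hom_add d.hom_closed h.hom_closed koszul_map_boundary)
  qed
  then have "koszul_map R L br ` (ce_boundaries R L br 3 +>\<^bsub>ext_power R L 3\<^esub> z)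
      = (\<lambda>_. koszul_map R L br z) ` (ce_boundaries R L br 3 +>\<^bsub>ext_power R L 3\<^esub> z)"
    by (rule image_cong[OF refl])
  moreover have "ce_boundaries R L br 3 +>\<^bsub>ext_power R L 3\<^esub> z \<noteq> {}"
    using d.M.M.zero_closed by (auto simp: a_r_coset_def' ce_boundaries_def)
  ultimately show ?thesis
    by (simp add: reduced_koszul_map_def quot_lift_def image_constant_conv)
qed

end

theorem theorem4p1:
  fixes R :: "('r, 'q) ring_scheme"
    and L :: "('r, 'g, 'e) module_scheme"
    and br :: "'g \<Rightarrow> 'g \<Rightarrow> 'g"
    and A :: "('a, 'f) monoid_scheme"
    and Gr :: "'a \<Rightarrow> 'g set"
    and K :: "'r set"
    and \<phi> :: "'a \<Rightarrow> 'r"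
  assumes "cring R"
    and "add_pow R (6::nat) \<one>\<^bsub>R\<^esub> \<in> Units R"
    and "graded_lie_algebra R L br A Gr"
    and "subfield K R"
    and "\<phi> \<in> hom A (add_monoid (R\<lparr>carrier := K\<rparr>))"
    and "inj_on \<phi> (carrier A)"
  shows "\<forall>\<alpha>\<in>carrier A - {\<one>\<^bsub>A\<^esub>}.
           reduced_koszul_map R L br ` ce_homology_deg R L br A Gr 3 \<alpha>
             = {\<zero>\<^bsub>killing_module R L br\<^esub>}"
proof
  fix \<alpha> assume \<alpha>: "\<alpha> \<in> carrier A - {\<one>\<^bsub>A\<^esub>}"
  interpret graded_lie_algebra R L br A Gr by fact
  interpret F: subfield K R by fact
  let ?K = "killing_module R L br" and ?E = "ext_power R L 3"
  interpret h: linear_map R ?E ?K "koszul_map R L br" by (rule koszul_map_linear)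
  interpret d: linear_map R ?E "ext_power R L 2" "ce_boundary R L br 3" by (rule ce_boundary_3_linear)
  have c: "\<phi> \<in> carrier A \<rightarrow> carrier R"
    using assms(5) F.subset by (auto simp: hom_def)
  have add: "\<phi> (\<beta> \<otimes>\<^bsub>A\<^esub> \<gamma>) = \<phi> \<beta> \<oplus>\<^bsub>R\<^esub> \<phi> \<gamma>" if "\<beta> \<in> carrier A" "\<gamma> \<in> carrier A" for \<beta> \<gamma>
    using assms(5) that by (simp add: hom_def)
  have "\<phi> \<one>\<^bsub>A\<^esub> \<oplus>\<^bsub>R\<^esub> \<phi> \<one>\<^bsub>A\<^esub> = \<phi> \<one>\<^bsub>A\<^esub>" using add[of "\<one>\<^bsub>A\<^esub>" "\<one>\<^bsub>A\<^esub>"] by simp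
  then have "\<phi> \<one>\<^bsub>A\<^esub> = \<zero>\<^bsub>R\<^esub>" using c by (simp add: Pi_iff)
  then have "\<phi> \<alpha> \<noteq> \<zero>\<^bsub>R\<^esub>" using \<alpha> inj_onD[OF assms(6), of \<alpha> "\<one>\<^bsub>A\<^esub>"] by auto
  moreover have "\<phi> \<alpha> \<in> K" using assms(5) \<alpha> by (auto simp: hom_def)
  \<comment> \<open>Nonzero becomes invertible inside the subfield; the inverse taken there is also
    an inverse in \<open>R\<close>, where it acts on the Killing module.\<close>
  ultimately have "\<phi> \<alpha> \<in> Units (R\<lparr>carrier := K\<rparr>)" using F.subfield_Units by simp
  then obtain b where b: "b \<in> carrier R" "b \<otimes>\<^bsub>R\<^esub> \<phi> \<alpha> = \<one>\<^bsub>R\<^esub>"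
    using F.subset by (auto simp: Units_def)
  have zero: "koszul_map R L br z = \<zero>\<^bsub>?K\<^esub>"
    if z: "z \<in> ce_cycles R L br 3" "z \<in> ext_power_deg R L A Gr 3 \<alpha>" for z
  proof -
    have "z \<in> carrier ?E" using z(1) by (simp add: ce_cycles_def a_kernel_def')
    then have "koszul_map R L br z = b \<odot>\<^bsub>?K\<^esub> (\<phi> \<alpha> \<odot>\<^bsub>?K\<^esub> koszul_map R L br z)"
      using b c \<alpha> by (simp add: K.P.smult_assoc1[symmetric] h.hom_closed Pi_iff)
    also have "\<dots> = \<zero>\<^bsub>?K\<^esub>"
      using koszul_map_weight_cycle[OF c add _ z] \<alpha> b(1) by simp
    finally show ?thesis .
  qed
  \<comment> \<open>The goal is an equality with a singleton, so the degree-\<alpha> part must be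
    nonempty: it contains the class of zero.\<close>
  have "\<zero>\<^bsub>?E\<^esub> \<in> ce_cycles R L br 3 \<inter> ext_power_deg R L A Gr 3 \<alpha>"
    by (auto simp: ce_cycles_def a_kernel_def' d.hom_zero ext_power_deg_def submod_span_def hull_def
        intro: h.M.submodule_zero)
  then have "ce_homology_deg R L br A Gr 3 \<alpha> \<noteq> {}"
    unfolding ce_homology_deg_def by blast
  moreover have "reduced_koszul_map R L br C = \<zero>\<^bsub>?K\<^esub>" if "C \<in> ce_homology_deg R L br A Gr 3 \<alpha>" for C
    using that zero by (auto simp: ce_homology_deg_def reduced_koszul_map_class)
  ultimately show "reduced_koszul_map R L br ` ce_homology_deg R L br A Gr 3 \<alpha> = {\<zero>\<^bsub>?K\<^esub>}"
    by (auto simp: image_iff)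
qed

end
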